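(* Let $0\le q\le t$ be integers, and let $Q^q_t$ and $R^q_t$ be the projectors defined in the context. Let $P_{q-1}$ be the $L^2(a,b)$-orthogonal projector onto $\mathcal{P}_{q-1}$. Then, for all $u\in H^q(a,b)$, $$E_{q-1}u := R^q_t u - Q^q_t u = P_{q-1}(u - Q^q_t u)\in \mathcal{P}_{q-1}.$$
   Context: Let $a<b$ be real. $(\cdot,\cdot)$ denotes the inner product of the real space $L^2(a,b)$. $\partial$ is the (weak) derivative, $H^q(a,b)=\{u\in L^2(a,b):\partial^\alpha u\in L^2(a,b),\ \alpha=1,\ldots,q\}$, $H^0(a,b)=L^2(a,b)$; for $u\in H^1(a,b)$ point values are those of the continuous representative. $\mathcal{P}_k$ is the space of polynomials of degree at most $k$ (restricted to $[a,b]$), and $\mathcal{P}_{-1}=\{0\}$. Define $(Kf)(x)=\int_a^x f(y)\,dy$ and its $L^2$-adjoint $(K^*f)(x)=\int_x^b f(y)\,dy$. Let $\mathcal{Z}_0\supseteq\mathcal{P}_0$ be any finite dimensional subspace of $L^2(a,b)$ and for integers $t\ge 1$ let $\mathcal{Z}_t:=\mathcal{P}_0+K(\mathcal{Z}_{t-1})$, where it is assumed that $\mathcal{P}_0+K(\mathcal{Z}_{t-1})=\mathcal{P}_0+K^*(\mathcal{Z}_{t-1})$ (sums need not be direct). Let $Z_t$ be the $L^2(a,b)$-orthogonal projector onto $\mathcal{Z}_t$. The projectors $Q_t^q:H^q(a,b)\to\mathcal{Z}_t$, $q=0,\ldots,t$, are defined recursively by $Q_t^0:=Z_t$ and, for $q\ge1$,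 $Q_t^q u:=u(a)+KQ_{t-1}^{q-1}\partial u$. The Ritz projector $R_t^q:H^q(a,b)\to\mathcal{Z}_t$, $q=0,\ldots,t$, is defined by: $R_t^qu\in\mathcal{Z}_t$ satisfies $(\partial^qR_t^qu,\partial^qv)=(\partial^qu,\partial^qv)$ for all $v\in\mathcal{Z}_t$, and $(R_t^qu,g)=(u,g)$ for all $g\in\mathcal{P}_{q-1}$. *)

theory Defs
  imports "HOL-Analysis.Analysis" "HOL-Computational_Algebra.Polynomial"
begin

text \<open>
  Elements of the real space \<open>L\<^sup>2(a,b)\<close> are represented by functions \<open>real \<Rightarrow> real\<close>; only their
  restriction to the open interval matters. Equality in \<open>L\<^sup>2(a,b)\<close> is \<open>L2_eq\<close>, and a subspace of
  \<open>L\<^sup>2(a,b)\<close> is represented by the set of all representatives of its elements, so that the sets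
  introduced below are closed under \<open>L2_eq\<close>.
\<close>

definition L2 :: "real \<Rightarrow> real \<Rightarrow> (real \<Rightarrow> real) set" where
  "L2 a b = {f \<in> borel_measurable (lebesgue_on {a<..<b}).
               integrable (lebesgue_on {a<..<b}) (\<lambda>x. (f x)\<^sup>2)}"

definition L2_eq :: "real \<Rightarrow> real \<Rightarrow> (real \<Rightarrow> real) \<Rightarrow> (real \<Rightarrow> real) \<Rightarrow> bool" where
  "L2_eq a b f g \<longleftrightarrow> (AE x in lebesgue_on {a<..<b}. f x = g x)"

definition L2_inner :: "real \<Rightarrow> real \<Rightarrow> (real \<Rightarrow> real) \<Rightarrow> (real \<Rightarrow> real) \<Rightarrow> real" where
  "L2_inner a b f g = (LINT x|lebesgue_on {a<..<b}. f x * g x)"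

definition fin_dim_subspace :: "real \<Rightarrow> real \<Rightarrow> (real \<Rightarrow> real) set \<Rightarrow> bool" where
  "fin_dim_subspace a b S \<longleftrightarrow>
     (\<exists>B. finite B \<and> B \<subseteq> L2 a b \<and>
          S = {f. \<exists>c. L2_eq a b f (\<lambda>x. \<Sum>g\<in>B. c g * g x)})"

text \<open>
  The degree bound is an integer so that \<open>\<P>\<^sub>-\<^sub>1 = {0}\<close> is covered; the library gives the zero
  polynomial degree \<open>0\<close>, hence the separate disjunct.
\<close>

definition poly_space :: "real \<Rightarrow> real \<Rightarrow> int \<Rightarrow> (real \<Rightarrow> real) set" where
  "poly_space a b k = {f. \<exists>p::real poly. (p = 0 \<or> int (degree p) \<le> k) \<and> L2_eq a b f (poly p)}"

text \<open>Projections, weak derivatives and continuous representatives are chosen representatives of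
  objects that are unique up to \<open>L2_eq\<close> whenever they exist.\<close>

definition L2_proj ::
    "real \<Rightarrow> real \<Rightarrow> (real \<Rightarrow> real) set \<Rightarrow> (real \<Rightarrow> real) \<Rightarrow> real \<Rightarrow> real" where
  "L2_proj a b S u = (SOME v. v \<in> S \<and> (\<forall>w\<in>S. L2_inner a b (\<lambda>x. u x - v x) w = 0))"

definition test_funs :: "real \<Rightarrow> real \<Rightarrow> (real \<Rightarrow> real) set" where
  "test_funs a b = {\<phi>. (\<forall>n x. ((deriv ^^ n) \<phi>) differentiable (at x)) \<and>
                       (\<exists>C. compact C \<and> C \<subseteq> {a<..<b} \<and> (\<forall>x. x \<notin> C \<longrightarrow> \<phi> x = 0))}"

definition has_weak_deriv ::
    "real \<Rightarrow> real \<Rightarrow> nat \<Rightarrow> (real \<Rightarrow> real) \<Rightarrow> (real \<Rightarrow> real) \<Rightarrow> bool" where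
  "has_weak_deriv a b n u v \<longleftrightarrow>
     (\<forall>\<phi>\<in>test_funs a b. L2_inner a b u ((deriv ^^ n) \<phi>) = (-1) ^ n * L2_inner a b v \<phi>)"

definition weak_deriv :: "real \<Rightarrow> real \<Rightarrow> nat \<Rightarrow> (real \<Rightarrow> real) \<Rightarrow> real \<Rightarrow> real" where
  "weak_deriv a b n u = (SOME v. v \<in> L2 a b \<and> has_weak_deriv a b n u v)"

definition sobolev :: "real \<Rightarrow> real \<Rightarrow> nat \<Rightarrow> (real \<Rightarrow> real) set" where
  "sobolev a b q = {u \<in> L2 a b. \<forall>\<alpha>\<in>{1..q}. \<exists>v\<in>L2 a b. has_weak_deriv a b \<alpha> u v}"

definition cont_rep :: "real \<Rightarrow> real \<Rightarrow> (real \<Rightarrow> real) \<Rightarrow> real \<Rightarrow> real" where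
  "cont_rep a b u = (SOME g. continuous_on {a..b} g \<and> L2_eq a b u g)"

definition K_op :: "real \<Rightarrow> (real \<Rightarrow> real) \<Rightarrow> real \<Rightarrow> real" where
  "K_op a f x = (LINT y|lebesgue_on {a<..<x}. f y)"

definition K_adj :: "real \<Rightarrow> (real \<Rightarrow> real) \<Rightarrow> real \<Rightarrow> real" where
  "K_adj b f x = (LINT y|lebesgue_on {x<..<b}. f y)"

text \<open>The subspace \<open>\<P>\<^sub>0 + T(S)\<close> for an integral operator \<open>T\<close>.\<close>

definition P0_plus_image ::
    "real \<Rightarrow> real \<Rightarrow> ((real \<Rightarrow> real) \<Rightarrow> real \<Rightarrow> real) \<Rightarrow> (real \<Rightarrow> real) set \<Rightarrow> (real \<Rightarrow> real) set" where
  "P0_plus_image a b T S = {\<lambda>x. p x + T g x |p g. p \<in> poly_space a b 0 \<and> g \<in> S}"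

primrec Z_space :: "real \<Rightarrow> real \<Rightarrow> (real \<Rightarrow> real) set \<Rightarrow> nat \<Rightarrow> (real \<Rightarrow> real) set" where
  "Z_space a b Z0 0 = Z0"
| "Z_space a b Z0 (Suc t) = P0_plus_image a b (K_op a) (Z_space a b Z0 t)"

text \<open>\<open>Q_proj a b Z0 q t\<close> is \<open>Q\<^sub>t\<^sup>q\<close>; it is meaningful only for \<open>q \<le> t\<close>, where \<open>t - 1\<close> does not
  truncate.\<close>

primrec Q_proj :: "real \<Rightarrow> real \<Rightarrow> (real \<Rightarrow> real) set \<Rightarrow> nat \<Rightarrow> nat \<Rightarrow> (real \<Rightarrow> real) \<Rightarrow> real \<Rightarrow> real"
where
  "Q_proj a b Z0 0 = (\<lambda>t u. L2_proj a b (Z_space a b Z0 t) u)"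
| "Q_proj a b Z0 (Suc q) =
     (\<lambda>t u x. cont_rep a b u a + K_op a (Q_proj a b Z0 q (t - 1) (weak_deriv a b 1 u)) x)"

definition Ritz_proj ::
    "real \<Rightarrow> real \<Rightarrow> (real \<Rightarrow> real) set \<Rightarrow> nat \<Rightarrow> nat \<Rightarrow> (real \<Rightarrow> real) \<Rightarrow> real \<Rightarrow> real" where
  "Ritz_proj a b Z0 q t u = (SOME r. r \<in> Z_space a b Z0 t \<and>
     (\<forall>v\<in>Z_space a b Z0 t. L2_inner a b (weak_deriv a b q r) (weak_deriv a b q v)
                            = L2_inner a b (weak_deriv a b q u) (weak_deriv a b q v)) \<and>
     (\<forall>g\<in>poly_space a b (int q - 1). L2_inner a b r g = L2_inner a b u g))"

end

theory Submission
  imports Defs "HOL-Real_Asymp.Real_Asymp"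
begin

text \<open>
  Write \<open>Q\<close> for \<open>Q_proj a b Z0 q t u\<close>. Every element of \<open>\<Z>\<^sub>t\<close> is a \<open>q\<close>-fold primitive of its weak
  derivative of order \<open>q\<close>, which lies in \<open>\<Z>\<^sub>t\<^sub>-\<^sub>q\<close>, and that of \<open>Q\<close> is the orthogonal projection of
  \<open>\<partial>\<^sup>q u\<close> onto \<open>\<Z>\<^sub>t\<^sub>-\<^sub>q\<close>. Adding to \<open>Q\<close> the projection of \<open>u - Q\<close> onto \<open>\<P>\<^sub>q\<^sub>-\<^sub>1\<close> leaves the derivative
  of order \<open>q\<close> unchanged and so gives a solution of the Ritz equations. The difference of two
  solutions has vanishing derivative of order \<open>q\<close>, hence lies in \<open>\<P>\<^sub>q\<^sub>-\<^sub>1\<close>; being orthogonal to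
  \<open>\<P>\<^sub>q\<^sub>-\<^sub>1\<close> it is zero.
\<close>

subsection \<open>Smooth functions with compact support\<close>


abbreviation smooth :: "(real \<Rightarrow> real) \<Rightarrow> bool" where
  "smooth f \<equiv> \<forall>n x. ((deriv ^^ n) f) differentiable (at x)"

text \<open>An induction on the order of the derivative, packaged once: a family of differentiable
  functions closed under \<open>deriv\<close> contains only smooth functions. Exhibiting such a
  family avoids explicit formulas for higher derivatives.\<close>

lemma smoothI_closed:
  assumes "f \<in> S" "\<And>g. g \<in> S \<Longrightarrow> (\<forall>x. g differentiable (at x)) \<and> deriv g \<in> S"
  shows "smooth f"
proof (intro allI)
  fix n x
  have "(deriv ^^ n) f \<in> S"
    by (induction n) (use assms in auto)
  then show "((deriv ^^ n) f) differentiable (at x)"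
    using assms by auto
qed

lemma smooth_differentiable: "smooth f \<Longrightarrow> f differentiable (at x)"
  by (metis funpow_0)

lemma smooth_deriv: "smooth f \<Longrightarrow> smooth (deriv f)"
  by (metis comp_apply funpow_Suc_right)

lemma smooth_DERIV: "smooth f \<Longrightarrow> (f has_real_derivative deriv f x) (at x)"
  using smooth_differentiable DERIV_deriv_iff_real_differentiable by blast

lemma smooth_continuous_on: "smooth f \<Longrightarrow> continuous_on A f"
  by (meson DERIV_isCont continuous_at_imp_continuous_on smooth_DERIV)

text \<open>Single products are not closed under \<open>deriv\<close>, since the product rule yields
  a sum of two. Closing under sums repairs this and makes the Leibniz formula unnecessary.\<close>

inductive_set products_span :: "(real \<Rightarrow> real) set" where
  prod: "smooth f \<Longrightarrow> smooth g \<Longrightarrow> (\<lambda>x. f x * g x) \<in> products_span"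
| add: "h \<in> products_span \<Longrightarrow> k \<in> products_span \<Longrightarrow> (\<lambda>x. h x + k x) \<in> products_span"

lemma smooth_mult:
  assumes "smooth f" "smooth g"
  shows "smooth (\<lambda>x. f x * g x)"
proof (rule smoothI_closed[where S = products_span])
  show "(\<lambda>x. f x * g x) \<in> products_span"
    using assms by (rule products_span.prod)
next
  fix h assume "h \<in> products_span"
  then have "\<exists>h'\<in>products_span. \<forall>x. (h has_real_derivative h' x) (at x)"
  proof induction
    case (prod f g)
    have "(\<lambda>x. deriv f x * g x + f x * deriv g x) \<in> products_span"
      using prod by (intro products_span.intros smooth_deriv)
    moreover have "((\<lambda>x. f x * g x) has_real_derivative deriv f x * g x + f x * deriv g x) (at x)"
      for x
      using DERIV_mult[OF smooth_DERIV[OF prod(1)] smooth_DERIV[OF prod(2)]]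
      by (simp add: algebra_simps)
    ultimately show ?case by (intro bexI) auto
  next
    case (add h k)
    then obtain h' k' where "h' \<in> products_span" "k' \<in> products_span"
      "\<forall>x. (h has_real_derivative h' x) (at x)" "\<forall>x. (k has_real_derivative k' x) (at x)"
      by blast
    then show ?case
      by (intro bexI[of _ "\<lambda>x. h' x + k' x"]) (auto intro: DERIV_add products_span.add)
  qed
  then obtain h' where "h' \<in> products_span" and h': "\<And>x. (h has_real_derivative h' x) (at x)"
    by blast
  moreover have "deriv h = h'"
    using h' by (intro ext DERIV_imp_deriv)
  ultimately show "(\<forall>x. h differentiable (at x)) \<and> deriv h \<in> products_span"
    using real_differentiable_def by auto
qed

lemma smooth_affine:
  assumes "smooth f"
  shows "smooth (\<lambda>x. f (m * x + s))"
\<comment> \<open>The factor \<open>r\<close> collects the powers of \<open>m\<close> that the chain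
  rule produces.\<close>
proof (rule smoothI_closed[where S = "{\<lambda>x. r * g (m * x + s) | r g. smooth g}"])
  show "(\<lambda>x. f (m * x + s)) \<in> {\<lambda>x. r * g (m * x + s) | r g. smooth g}"
    using assms by (auto intro!: exI[of _ 1])
next
  fix h assume "h \<in> {\<lambda>x. r * g (m * x + s) | r g. smooth g}"
  then obtain r g where h: "h = (\<lambda>x. r * g (m * x + s))" and g: "smooth g" by blast
  have D: "(h has_real_derivative r * m * deriv g (m * x + s)) (at x)" for x
  proof -
    have "((\<lambda>x. g (m * x + s)) has_real_derivative deriv g (m * x + s) * m) (at x)"
      by (rule DERIV_chain2[OF smooth_DERIV[OF g]]) (auto intro!: derivative_eq_intros)
    from DERIV_cmult[OF this, of r] show ?thesis unfolding h by (simp add: ac_simps)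
  qed
  then have "deriv h = (\<lambda>x. (r * m) * deriv g (m * x + s))"
    by (intro ext DERIV_imp_deriv)
  then show "(\<forall>x. h differentiable (at x)) \<and> deriv h \<in> {\<lambda>x. r * g (m * x + s) | r g. smooth g}"
    using D smooth_deriv[OF g] real_differentiable_def by blast
qed

text \<open>\<open>flat 1\<close> is the classical function exp(-1/x), extended by 0 to x \<le> 0.
  The polynomial in 1/x is there because differentiation produces such factors.\<close>

definition flat :: "real poly \<Rightarrow> real \<Rightarrow> real" where
  "flat p x = (if x > 0 then poly p (1/x) * exp (-(1/x)) else 0)"

lemma poly_exp_decay: "((\<lambda>y::real. poly p y * exp (-y)) \<longlongrightarrow> 0) at_top"
proof -
  have "((\<lambda>y::real. \<Sum>i\<le>degree p. coeff p i * (y ^ i / exp y)) \<longlongrightarrow> (\<Sum>i\<le>degree p. coeff p i * 0)) at_top"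
    by (intro tendsto_intros tendsto_power_div_exp_0)
  then show ?thesis
    by (simp add: poly_altdef sum_distrib_right exp_minus divide_inverse mult.assoc)
qed

text \<open>With y = 1/x the derivative of p(y) exp(-y) is y^2 (p(y) - p'(y)) exp(-y), and
  \<open>[:0,0,1:]\<close> is y^2. At the origin exponential decay beats every polynomial in 1/x.
  Hence the range of \<open>flat\<close> is closed under \<open>deriv\<close>.\<close>

lemma DERIV_flat:
  "(flat p has_real_derivative flat ([:0,0,1:] * (p - pderiv p)) x) (at x)"
proof -
  consider "x < 0" | "x = 0" | "x > 0" by linarith
  then show ?thesis
  proof cases
    case 1
    have "((\<lambda>x. 0) has_real_derivative 0) (at x)" by simp
    then have "(flat p has_real_derivative 0) (at x)"
      by (rule has_field_derivative_transform_within_open[where S = "{..<0}"])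
        (use 1 in \<open>auto simp: flat_def\<close>)
    then show ?thesis using 1 by (simp add: flat_def)
  next
    case 3
    have "((\<lambda>x. poly p (1/x) * exp (-(1/x))) has_real_derivative
       flat ([:0,0,1:] * (p - pderiv p)) x) (at x)"
      using 3
      by (auto intro!: derivative_eq_intros DERIV_chain2[OF poly_DERIV] simp: flat_def)
        (simp add: field_simps power2_eq_square)
    then show ?thesis
      by (rule has_field_derivative_transform_within_open[where S = "{0<..}"])
        (use 3 in \<open>auto simp: flat_def\<close>)
  next
    case 2
    have "((\<lambda>y. flat p y / y) \<longlongrightarrow> 0) (at 0)"
    proof (rule filterlim_split_at)
      show "((\<lambda>y. flat p y / y) \<longlongrightarrow> 0) (at_left 0)"
        by (rule tendsto_eventually) (auto simp: flat_def eventually_at_filter)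
      \<comment> \<open>Dividing by x is multiplying by 1/x, which \<open>pCons 0 p\<close> absorbs
        into the polynomial.\<close>
      have "((\<lambda>y::real. poly (pCons 0 p) (inverse y) * exp (- inverse y)) \<longlongrightarrow> 0) (at_right 0)"
        using filterlim_compose[OF poly_exp_decay filterlim_inverse_at_top_right] .
      then show "((\<lambda>y. flat p y / y) \<longlongrightarrow> 0) (at_right 0)"
        by (rule Lim_transform_eventually)
          (auto simp: flat_def eventually_at_filter field_simps)
    qed
    then show ?thesis
      using 2 by (simp add: has_field_derivative_iff flat_def)
  qed
qed

lemma smooth_flat: "smooth (flat p)"
proof (rule smoothI_closed[where S = "range flat"])
  fix g assume "g \<in> range flat"
  then obtain r where r: "g = flat r" by blast
  have "deriv g = flat ([:0,0,1:] * (r - pderiv r))"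
    unfolding r by (intro ext DERIV_imp_deriv DERIV_flat)
  then show "(\<forall>x. g differentiable (at x)) \<and> deriv g \<in> range flat"
    unfolding r using DERIV_flat real_differentiable_def by blast
qed auto

lemma flat_1_bounds: "0 \<le> flat 1 x" "flat 1 x \<le> 1"
  by (auto simp: flat_def)

text \<open>Supported in \<open>[c + 1/(k+1), d - 1/(k+1)]\<close>, and converging to the indicator of \<open>(c, d)\<close>.\<close>

definition bump :: "real \<Rightarrow> real \<Rightarrow> nat \<Rightarrow> real \<Rightarrow> real" where
  "bump c d k x = flat 1 (real (Suc k) * (x - c) - 1) * flat 1 (real (Suc k) * (d - x) - 1)"

lemma smooth_bump: "smooth (bump c d k)"
proof -
  have "smooth (\<lambda>x. flat 1 (real (Suc k) * x + (- real (Suc k) * c - 1)) *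
                    flat 1 ((- real (Suc k)) * x + (real (Suc k) * d - 1)))"
    by (intro smooth_mult smooth_affine smooth_flat)
  moreover have "(\<lambda>x. flat 1 (real (Suc k) * x + (- real (Suc k) * c - 1)) *
                    flat 1 ((- real (Suc k)) * x + (real (Suc k) * d - 1))) = bump c d k"
    unfolding bump_def by (intro ext arg_cong2[where f = "(*)"] arg_cong[where f = "flat 1"])
      (simp_all add: algebra_simps)
  ultimately show ?thesis by simp
qed

lemma bump_test_funs:
  assumes "a \<le> c" "d \<le> b"
  shows "bump c d k \<in> test_funs a b"
proof -
  \<comment> \<open>For small \<open>k\<close> this interval may be empty; the bump is then
    identically zero.\<close>
  let ?C = "{c + 1 / real (Suc k) .. d - 1 / real (Suc k)}"
  have "bump c d k x = 0" if "x \<notin> ?C" for x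
  proof -
    have "real (Suc k) * (x - c) - 1 \<le> 0 \<or> real (Suc k) * (d - x) - 1 \<le> 0"
      using that by (auto simp: field_simps)
    then show ?thesis by (auto simp: bump_def flat_def)
  qed
  moreover have "?C \<subseteq> {a<..<b}"
  proof
    fix x assume "x \<in> ?C"
    moreover have "1 / real (Suc k) > 0" by simp
    ultimately show "x \<in> {a<..<b}"
      using assms unfolding greaterThanLessThan_iff atLeastAtMost_iff by linarith
  qed
  ultimately show ?thesis
    using smooth_bump compact_Icc unfolding test_funs_def by blast
qed

lemma abs_bump_le: "\<bar>bump c d k x\<bar> \<le> 1"
  using flat_1_bounds by (simp add: bump_def abs_mult mult_le_one)

lemma bump_LIMSEQ: "(\<lambda>k. bump c d k x) \<longlonglongrightarrow> indicator {c<..<d} x"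
proof -
  \<comment> \<open>For z > 0 the argument tends to infinity, where \<open>flat 1\<close> tends to
    exp 0 = 1; otherwise the argument is never positive.\<close>
  have flat_lim: "(\<lambda>k. flat 1 (real (Suc k) * z - 1)) \<longlonglongrightarrow> (if z > 0 then 1 else 0)" for z :: real
  proof (cases "z > 0")
    case True
    have "\<forall>\<^sub>F k in sequentially. real (Suc k) * z - 1 > 0"
      using True by real_asymp
    moreover have "(\<lambda>k. exp (-(1 / (real (Suc k) * z - 1)))) \<longlonglongrightarrow> 1"
      using True by real_asymp
    ultimately show ?thesis
      using True by (auto elim!: Lim_transform_eventually eventually_mono simp: flat_def)
  next
    case False
    then have "real (Suc k) * z - 1 \<le> 0" for k
      by (smt (verit) mult_nonneg_nonpos of_nat_0_le_iff)
    then have "flat 1 (real (Suc k) * z - 1) = 0" for k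
      unfolding flat_def by (meson not_less)
    then show ?thesis using False by simp
  qed
  have "(\<lambda>k. bump c d k x) \<longlonglongrightarrow> (if x - c > 0 then 1 else 0) * (if d - x > 0 then 1 else 0)"
    unfolding bump_def by (intro tendsto_mult flat_lim)
  also have "(if x - c > 0 then 1 else 0) * (if d - x > 0 then 1 else 0) = (indicator {c<..<d} x :: real)"
    by (auto simp: indicator_def)
  finally show ?thesis .
qed

subsection \<open>Square integrable functions and weak derivatives\<close>


lemma finite_measure_Ioo: "finite_measure (lebesgue_on {a<..<b::real})"
  by (rule finite_measure_lebesgue_on) simp

lemma L2_measurable: "f \<in> L2 a b \<Longrightarrow> f \<in> borel_measurable (lebesgue_on {a<..<b})"
  by (simp add: L2_def)

lemma L2_mult_integrable:
  assumes f: "f \<in> L2 a b" and g: "g \<in> L2 a b"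
  shows "integrable (lebesgue_on {a<..<b}) (\<lambda>x. f x * g x)"
proof (rule Bochner_Integration.integrable_bound)
  show "integrable (lebesgue_on {a<..<b}) (\<lambda>x. (f x)\<^sup>2 + (g x)\<^sup>2)"
    using f g by (simp add: L2_def)
  show "(\<lambda>x. f x * g x) \<in> borel_measurable (lebesgue_on {a<..<b})"
    using f g by (intro borel_measurable_times L2_measurable)
  have "\<bar>y * z\<bar> \<le> y\<^sup>2 + z\<^sup>2" for y z :: real
  proof -
    have "2 * \<bar>y\<bar> * \<bar>z\<bar> \<le> y\<^sup>2 + z\<^sup>2"
      using zero_le_power2[of "\<bar>y\<bar> - \<bar>z\<bar>"] by (simp add: power2_diff)
    then show ?thesis
      using mult_nonneg_nonneg[of "\<bar>y\<bar>" "\<bar>z\<bar>"] unfolding abs_mult by linarith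
  qed
  then show "AE x in lebesgue_on {a<..<b}. norm (f x * g x) \<le> norm ((f x)\<^sup>2 + (g x)\<^sup>2)"
    by simp
qed

lemma bounded_L2:
  assumes "f \<in> borel_measurable (lebesgue_on {a<..<b})" "\<And>x. x \<in> {a<..<b} \<Longrightarrow> \<bar>f x\<bar> \<le> C"
  shows "f \<in> L2 a b"
proof -
  interpret finite_measure "lebesgue_on {a<..<b}" by (rule finite_measure_Ioo)
  have "AE x in lebesgue_on {a<..<b}. norm ((f x)\<^sup>2) \<le> C\<^sup>2"
  proof (rule AE_I2)
    fix x assume "x \<in> space (lebesgue_on {a<..<b})"
    then have "\<bar>f x\<bar> \<le> C" using assms(2) by simp
    then show "norm ((f x)\<^sup>2) \<le> C\<^sup>2"
      by (metis abs_ge_zero norm_power power_mono real_norm_def)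
  qed
  then have "integrable (lebesgue_on {a<..<b}) (\<lambda>x. (f x)\<^sup>2)"
    using assms(1) by (intro integrable_const_bound) auto
  then show ?thesis using assms(1) by (simp add: L2_def)
qed

lemma continuous_L2:
  assumes "continuous_on {a..b} f"
  shows "f \<in> L2 a b"
proof -
  have "bounded (f ` {a..b})"
    using assms by (intro compact_imp_bounded compact_continuous_image) auto
  then obtain C where "\<And>x. x \<in> {a..b} \<Longrightarrow> \<bar>f x\<bar> \<le> C"
    unfolding bounded_iff by force
  moreover have "f \<in> borel_measurable (lebesgue_on {a<..<b})"
    by (rule continuous_imp_measurable_on_sets_lebesgue)
      (auto intro: continuous_on_subset[OF assms])
  ultimately show ?thesis by (intro bounded_L2[where C = C]) auto
qed

lemma const_L2: "(\<lambda>x. c) \<in> L2 a b"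
  by (intro continuous_L2 continuous_intros)

lemma L2_integrable: "f \<in> L2 a b \<Longrightarrow> integrable (lebesgue_on {a<..<b}) f"
  using L2_mult_integrable[of f a b "\<lambda>x. 1"] const_L2 by simp

lemma L2_lin:
  assumes "f \<in> L2 a b" "g \<in> L2 a b"
  shows "(\<lambda>x. f x + c * g x) \<in> L2 a b"
proof -
  have "integrable (lebesgue_on {a<..<b}) (\<lambda>x. f x * f x + 2 * c * (f x * g x) + c\<^sup>2 * (g x * g x))"
    using assms by (intro Bochner_Integration.integrable_add integrable_mult_right L2_mult_integrable)
  moreover have "(\<lambda>x. f x * f x + 2 * c * (f x * g x) + c\<^sup>2 * (g x * g x)) = (\<lambda>x. (f x + c * g x)\<^sup>2)"
    by (auto simp: power2_eq_square algebra_simps)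
  moreover have "(\<lambda>x. f x + c * g x) \<in> borel_measurable (lebesgue_on {a<..<b})"
    using assms[THEN L2_measurable] by (intro borel_measurable_add borel_measurable_times) auto
  ultimately show ?thesis by (simp add: L2_def)
qed

lemma L2_diff: "f \<in> L2 a b \<Longrightarrow> g \<in> L2 a b \<Longrightarrow> (\<lambda>x. f x - g x) \<in> L2 a b"
  using L2_lin[of f a b g "-1"] by simp

lemma L2_add: "f \<in> L2 a b \<Longrightarrow> g \<in> L2 a b \<Longrightarrow> (\<lambda>x. f x + g x) \<in> L2 a b"
  using L2_lin[of f a b g 1] by simp

lemma L2_inner_lin:
  assumes "f \<in> L2 a b" "g \<in> L2 a b" "h \<in> L2 a b"
  shows "L2_inner a b (\<lambda>x. f x + c * g x) h = L2_inner a b f h + c * L2_inner a b g h"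
proof -
  have "L2_inner a b (\<lambda>x. f x + c * g x) h
      = (LINT x|lebesgue_on {a<..<b}. f x * h x + c * (g x * h x))"
    unfolding L2_inner_def by (simp add: algebra_simps)
  also have "\<dots> = L2_inner a b f h + c * L2_inner a b g h"
    unfolding L2_inner_def using assms
    by (subst Bochner_Integration.integral_add) (auto intro!: L2_mult_integrable)
  finally show ?thesis .
qed

lemma L2_inner_diff:
  assumes "f \<in> L2 a b" "g \<in> L2 a b" "h \<in> L2 a b"
  shows "L2_inner a b (\<lambda>x. f x - g x) h = L2_inner a b f h - L2_inner a b g h"
  using L2_inner_lin[OF assms, of "-1"] by simp

lemma L2_inner_commute: "L2_inner a b f g = L2_inner a b g f"
  by (simp add: L2_inner_def mult.commute)

section \<open>Almost everywhere equality\<close>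

lemma L2_eq_refl [simp]: "L2_eq a b f f"
  by (simp add: L2_eq_def)

lemma L2_eq_trans [trans]: "L2_eq a b f g \<Longrightarrow> L2_eq a b g h \<Longrightarrow> L2_eq a b f h"
  unfolding L2_eq_def by (rule AE_mp, assumption) (auto elim: AE_mp)

lemma L2_eq_lin:
  "L2_eq a b f f' \<Longrightarrow> L2_eq a b g g' \<Longrightarrow> L2_eq a b (\<lambda>x. f x + c * g x) (\<lambda>x. f' x + c * g' x)"
  unfolding L2_eq_def by (rule AE_mp, assumption) (auto elim: AE_mp)

lemma L2_eqI: "(\<And>x. x \<in> {a<..<b} \<Longrightarrow> f x = g x) \<Longrightarrow> L2_eq a b f g"
  unfolding L2_eq_def by (rule AE_I2) simp

lemma L2_eq_diff_0: "L2_eq a b (\<lambda>x. f x - g x) (\<lambda>x. 0) \<longleftrightarrow> L2_eq a b f g"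
  by (simp add: L2_eq_def)

text \<open>Lebesgue measure is complete, so changing a measurable function on a null set keeps it
  measurable.\<close>

lemma L2_eq_measurable:
  assumes "L2_eq a b f g" "g \<in> borel_measurable (lebesgue_on {a<..<b})"
  shows "f \<in> borel_measurable (lebesgue_on {a<..<b})"
proof -
  have "AE x in lebesgue. indicator {a<..<b} x *\<^sub>R g x = indicator {a<..<b} x *\<^sub>R f x"
    using assms(1) unfolding L2_eq_def by (subst (asm) AE_restrict_space_iff) (auto elim!: eventually_mono simp: indicator_def)
  moreover have "(\<lambda>x. indicator {a<..<b} x *\<^sub>R g x) \<in> borel_measurable lebesgue"
    using assms(2) by (simp add: borel_measurable_restrict_space_iff)
  ultimately have "(\<lambda>x. indicator {a<..<b} x *\<^sub>R f x) \<in> borel_measurable lebesgue"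
    by (rule borel_measurable_AE[rotated])
  then show ?thesis
    by (simp add: borel_measurable_restrict_space_iff)
qed

lemma L2_eq_L2:
  assumes "L2_eq a b f g" "g \<in> L2 a b"
  shows "f \<in> L2 a b"
proof -
  have f: "f \<in> borel_measurable (lebesgue_on {a<..<b})"
    using assms L2_eq_measurable L2_measurable by blast
  moreover have "integrable (lebesgue_on {a<..<b}) (\<lambda>x. (f x)\<^sup>2) \<longleftrightarrow>
      integrable (lebesgue_on {a<..<b}) (\<lambda>x. (g x)\<^sup>2)"
    using assms L2_measurable[OF assms(2)] f by (intro integrable_cong_AE) (auto simp: L2_eq_def)
  ultimately show ?thesis using assms by (simp add: L2_def)
qed

lemma L2_inner_cong:
  assumes "L2_eq a b f f'" "f' \<in> L2 a b" "h \<in> L2 a b"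
  shows "L2_inner a b f h = L2_inner a b f' h"
  unfolding L2_inner_def using assms L2_eq_measurable[OF assms(1)] L2_measurable
  by (intro integral_cong_AE) (auto simp: L2_eq_def)

lemma L2_inner_self_0:
  assumes "f \<in> L2 a b" "L2_inner a b f f = 0"
  shows "L2_eq a b f (\<lambda>x. 0)"
  using assms integral_nonneg_eq_0_iff_AE[of "lebesgue_on {a<..<b}" "\<lambda>x. f x * f x"]
    L2_mult_integrable[OF assms(1) assms(1)]
  by (simp add: L2_inner_def L2_eq_def)

section \<open>Integrals over subintervals\<close>

lemma integral_lebesgue_on_Ioo_subset:
  fixes f :: "real \<Rightarrow> real"
  assumes "{c<..<d} \<subseteq> {a<..<b}"
  shows "(LINT y|lebesgue_on {c<..<d}. f y) = (LINT y|lebesgue_on {a<..<b}. indicator {c<..<d} y * f y)"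
proof -
  have "(\<lambda>x. indicator {a<..<b} x * (indicator {c<..<d} x * f x)) = (\<lambda>x. indicator {c<..<d} x * f x)"
    using assms by (auto simp: indicator_def fun_eq_iff)
  then show ?thesis
    by (simp add: integral_restrict_space)
qed

lemma integral_lebesgue_on_Ioo_FTC:
  fixes F f :: "real \<Rightarrow> real"
  assumes "c \<le> d" "\<And>x. x \<in> {c..d} \<Longrightarrow> (F has_real_derivative f x) (at x)" "continuous_on {c..d} f"
  shows "(LINT y|lebesgue_on {c<..<d}. f y) = F d - F c"
proof -
  have "(f has_integral (F d - F c)) {c..d}"
    using assms by (intro fundamental_theorem_of_calculus)
      (auto simp: has_real_derivative_iff_has_vector_derivative[symmetric] intro: has_field_derivative_at_within)
  then have "(f has_integral (F d - F c)) {c<..<d}"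
    using has_integral_open_interval[of f "F d - F c" c d] by simp
  moreover have "integrable (lebesgue_on {c<..<d}) f"
    by (rule L2_integrable, rule continuous_L2, rule assms)
  ultimately show ?thesis
    using lebesgue_integral_eq_integral[of "{c<..<d}" f] by (simp add: integral_unique)
qed

section \<open>Test functions and weak derivatives\<close>

lemma test_funs_smooth: "\<phi> \<in> test_funs a b \<Longrightarrow> smooth \<phi>"
  by (simp add: test_funs_def)

lemma test_funs_0: "\<phi> \<in> test_funs a b \<Longrightarrow> x \<notin> {a<..<b} \<Longrightarrow> \<phi> x = 0"
  by (auto simp: test_funs_def)

lemma test_funs_L2: "\<phi> \<in> test_funs a b \<Longrightarrow> \<phi> \<in> L2 a b"
  by (intro continuous_L2 smooth_continuous_on test_funs_smooth)

lemma test_funs_deriv: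
  assumes "\<phi> \<in> test_funs a b"
  shows "deriv \<phi> \<in> test_funs a b"
proof -
  obtain C where C: "compact C" "C \<subseteq> {a<..<b}" "\<And>x. x \<notin> C \<Longrightarrow> \<phi> x = 0"
    using assms by (auto simp: test_funs_def)
  have "deriv \<phi> x = 0" if "x \<notin> C" for x
  proof (rule DERIV_imp_deriv)
    have "((\<lambda>x. 0::real) has_real_derivative 0) (at x)" by simp
    then show "(\<phi> has_real_derivative 0) (at x)"
      by (rule has_field_derivative_transform_within_open[where S = "- C"])
        (use that C compact_imp_closed in auto)
  qed
  then show ?thesis
    using C smooth_deriv[OF test_funs_smooth[OF assms]] unfolding test_funs_def by blast
qed

lemma test_funs_higher_deriv: "\<phi> \<in> test_funs a b \<Longrightarrow> (deriv ^^ n) \<phi> \<in> test_funs a b"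
  by (induction n) (auto intro: test_funs_deriv)

text \<open>Dominated convergence along bumps passes from test functions to indicators, so
  \<open>v\<close> has integral zero over every subinterval. Lebesgue differentiation then recovers
  \<open>v\<close> almost everywhere from its vanishing averages.\<close>

lemma fundamental_lemma:
  assumes v: "v \<in> L2 a b" and 0: "\<And>\<phi>. \<phi> \<in> test_funs a b \<Longrightarrow> L2_inner a b v \<phi> = 0"
  shows "L2_eq a b v (\<lambda>x. 0)"
proof -
  have Ioo: "(LINT x|lebesgue_on {a<..<b}. v x * indicator {c<..<d} x) = 0"
    if "a \<le> c" "d \<le> b" for c d
  proof -
    have "(\<lambda>k. LINT x|lebesgue_on {a<..<b}. v x * bump c d k x) \<longlonglongrightarrow>
          (LINT x|lebesgue_on {a<..<b}. v x * indicator {c<..<d} x)"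
    proof (rule integral_dominated_convergence)
      show "(\<lambda>x. v x * indicator {c<..<d} x) \<in> borel_measurable (lebesgue_on {a<..<b})"
        by (intro borel_measurable_times L2_measurable[OF v] measurable_restrict_space1
            borel_measurable_indicator) auto
      show "(\<lambda>x. v x * bump c d k x) \<in> borel_measurable (lebesgue_on {a<..<b})" for k
        using that by (intro borel_measurable_times L2_measurable v test_funs_L2 bump_test_funs)
      show "integrable (lebesgue_on {a<..<b}) (\<lambda>x. \<bar>v x\<bar>)"
        using L2_integrable[OF v] by simp
      show "AE x in lebesgue_on {a<..<b}. (\<lambda>k. v x * bump c d k x) \<longlonglongrightarrow> v x * indicator {c<..<d} x"
        by (intro AE_I2 tendsto_mult tendsto_const bump_LIMSEQ)
      show "AE x in lebesgue_on {a<..<b}. norm (v x * bump c d k x) \<le> \<bar>v x\<bar>" for k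
        using abs_bump_le by (auto simp: abs_mult mult_left_le)
    qed
    moreover have "(LINT x|lebesgue_on {a<..<b}. v x * bump c d k x) = 0" for k
      using 0[OF bump_test_funs[of a c d b k]] that by (simp add: L2_inner_def)
    ultimately show ?thesis
      by (simp add: LIMSEQ_const_iff)
  qed
  \<comment> \<open>Extension by zero to the whole line, the setting of the differentiation
    theorem.\<close>
  define w where "w x = indicator {a<..<b} x * v x" for x
  have w_int: "integrable lebesgue w"
    using L2_integrable[OF v] unfolding w_def by (simp add: integrable_restrict_space)
  have w0: "(w has_integral 0) (cbox c d)" for c d
  proof -
    have "(LINT x|lebesgue_on {c<..<d}. w x) = (LINT x|lebesgue. indicator {c<..<d} x * w x)"
      by (simp add: integral_restrict_space)
    \<comment> \<open>Clipping (c,d) to (a,b) brings it within reach of \<open>Ioo\<close>; the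
      clipped interval may be empty.\<close>
    also have "\<dots> = (LINT x|lebesgue. indicator {a<..<b} x * (v x * indicator {max a c<..<min b d} x))"
      by (intro Bochner_Integration.integral_cong) (auto simp: w_def indicator_def)
    also have "\<dots> = 0"
      using Ioo[of "max a c" "min b d"] by (simp add: integral_restrict_space)
    finally have "(LINT x|lebesgue_on {c<..<d}. w x) = 0" .
    moreover have "integrable (lebesgue_on {c<..<d}) w"
      using w_int integrable_mult_indicator[of "{c<..<d}" lebesgue w]
      by (simp add: integrable_restrict_space)
    ultimately have "(w has_integral 0) {c<..<d}"
      using has_integral_integral_lebesgue_on[of "{c<..<d}" w] by simp
    then show ?thesis
      using has_integral_open_interval[of w 0 c d] by simp
  qed
  \<comment> \<open>The Lebesgue differentiation theorem: off the null set \<open>N\<close>, the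
    averages of \<open>w\<close> over [x, x+h] tend to \<open>w x\<close>. By \<open>w0\<close> all
    these averages are 0.\<close>
  obtain N where N: "negligible N" and
    lim: "\<And>x e. \<lbrakk>x \<notin> N; 0 < e\<rbrakk> \<Longrightarrow>
               \<exists>d>0. \<forall>h. 0 < h \<and> h < d \<longrightarrow>
                         norm (integral (cbox x (x + h *\<^sub>R One)) w /\<^sub>R h ^ DIM(real) - w x) < e"
    using integrable_ccontinuous_explicit[of w] w0 by blast
  have "w x = 0" if x: "x \<notin> N" for x
  proof (rule ccontr)
    assume "w x \<noteq> 0"
    then obtain d where "d > 0" and d: "\<And>h. 0 < h \<Longrightarrow> h < d \<Longrightarrow>
        norm (integral (cbox x (x + h *\<^sub>R One)) w /\<^sub>R h ^ DIM(real) - w x) < \<bar>w x\<bar>"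
      using lim[OF x, of "\<bar>w x\<bar>"] by auto
    from d[of "d/2"] \<open>d > 0\<close> show False
      using integral_unique[OF w0] by simp
  qed
  moreover have "AE x in lebesgue. x \<notin> N"
    using N by (metis AE_not_in negligible_iff_null_sets)
  ultimately have "AE x in lebesgue. w x = 0"
    by (auto elim: AE_mp)
  then show ?thesis
    unfolding L2_eq_def w_def by (subst AE_restrict_space_iff) (auto elim: AE_mp)
qed

lemma has_weak_deriv_unique:
  assumes "v \<in> L2 a b" "w \<in> L2 a b" "has_weak_deriv a b n u v" "has_weak_deriv a b n u w"
  shows "L2_eq a b v w"
proof -
  have "L2_eq a b (\<lambda>x. v x - w x) (\<lambda>x. 0)"
  proof (rule fundamental_lemma)
    show "(\<lambda>x. v x - w x) \<in> L2 a b" using assms L2_diff by blast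
    fix \<phi> assume "\<phi> \<in> test_funs a b"
    then show "L2_inner a b (\<lambda>x. v x - w x) \<phi> = 0"
      using assms by (auto simp: has_weak_deriv_def L2_inner_diff test_funs_L2)
  qed
  then show ?thesis by (simp add: L2_eq_diff_0)
qed

text \<open>\<open>weak_deriv\<close> is a choice: one square integrable weak derivative guarantees
  that the choice is a genuine one, and uniqueness compares the two.\<close>

lemma weak_deriv_props:
  assumes "v \<in> L2 a b" "has_weak_deriv a b n u v"
  shows "weak_deriv a b n u \<in> L2 a b" "has_weak_deriv a b n u (weak_deriv a b n u)"
    and "L2_eq a b (weak_deriv a b n u) v"
proof -
  show *: "weak_deriv a b n u \<in> L2 a b" "has_weak_deriv a b n u (weak_deriv a b n u)"
    using someI[of "\<lambda>v. v \<in> L2 a b \<and> has_weak_deriv a b n u v" v] assms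
    by (auto simp: weak_deriv_def)
  show "L2_eq a b (weak_deriv a b n u) v"
    using has_weak_deriv_unique * assms by blast
qed

lemma has_weak_deriv_0: "has_weak_deriv a b 0 u u"
  by (simp add: has_weak_deriv_def)

lemma has_weak_deriv_lin:
  assumes "u \<in> L2 a b" "v \<in> L2 a b" "u' \<in> L2 a b" "v' \<in> L2 a b"
    and "has_weak_deriv a b n u u'" "has_weak_deriv a b n v v'"
  shows "has_weak_deriv a b n (\<lambda>x. u x + c * v x) (\<lambda>x. u' x + c * v' x)"
  using assms unfolding has_weak_deriv_def
  by (simp add: L2_inner_lin test_funs_L2 test_funs_higher_deriv algebra_simps)

text \<open>The \<open>n\<close>-th derivative of a test function is again a test function, so the
  first-order identity may be applied to it. The same observation gives the converse direction
  below.\<close>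

lemma has_weak_deriv_Suc:
  assumes "has_weak_deriv a b 1 u w" "has_weak_deriv a b n w v"
  shows "has_weak_deriv a b (Suc n) u v"
  using assms test_funs_higher_deriv[of _ a b n] by (simp add: has_weak_deriv_def)

lemma has_weak_deriv_SucD:
  assumes "has_weak_deriv a b 1 u w" "has_weak_deriv a b (Suc n) u v"
  shows "has_weak_deriv a b n w v"
  using assms test_funs_higher_deriv[of _ a b n] by (fastforce simp: has_weak_deriv_def)

lemma has_weak_deriv_cong:
  assumes "L2_eq a b u u'" "u' \<in> L2 a b" "has_weak_deriv a b n u' v"
  shows "has_weak_deriv a b n u v"
  using assms L2_inner_cong[OF assms(1,2)]
  by (simp add: has_weak_deriv_def test_funs_L2 test_funs_higher_deriv)

subsection \<open>The integral operator\<close>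


lemma measurable_id_Ioo [measurable]: "(\<lambda>x. x) \<in> borel_measurable (lebesgue_on {a<..<b::real})"
  by (rule L2_measurable, rule continuous_L2) (rule continuous_on_id)

lemma measurable_truncation:
  fixes g :: "real \<Rightarrow> real"
  assumes [measurable]: "g \<in> borel_measurable (lebesgue_on {a<..<b})"
  shows "(\<lambda>(x, y). (if y < x then g y else 0)) \<in>
    borel_measurable (lebesgue_on {a<..<b} \<Otimes>\<^sub>M lebesgue_on {a<..<b})"
  by measurable

text \<open>Moving \<open>x\<close> from the domain of integration into the integrand leaves a fixed
  finite measure, as needed for parameter integrals and Fubini.\<close>

lemma K_op_eq:
  assumes "x \<in> {a<..<b}"
  shows "K_op a g x = (LINT y|lebesgue_on {a<..<b}. (if y < x then g y else 0))"
proof -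
  have "K_op a g x = (LINT y|lebesgue_on {a<..<b}. indicator {a<..<x} y * g y)"
    unfolding K_op_def using assms by (intro integral_lebesgue_on_Ioo_subset) auto
  also have "\<dots> = (LINT y|lebesgue_on {a<..<b}. (if y < x then g y else 0))"
    by (intro Bochner_Integration.integral_cong) (auto simp: indicator_def)
  finally show ?thesis .
qed

lemma truncation_integrable:
  fixes g :: "real \<Rightarrow> real"
  assumes "g \<in> L2 a b"
  shows "integrable (lebesgue_on {a<..<b}) (\<lambda>y. (if y < x then g y else 0))"
proof (rule Bochner_Integration.integrable_bound)
  show "integrable (lebesgue_on {a<..<b}) g" by (rule L2_integrable[OF assms])
  note L2_measurable[OF assms, measurable]
  show "(\<lambda>y. (if y < x then g y else 0)) \<in> borel_measurable (lebesgue_on {a<..<b})"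
    by measurable
qed auto

text \<open>A primitive is bounded by the L^1 norm of its integrand, and a bounded measurable
  function on a bounded interval is square integrable.\<close>

lemma K_op_L2:
  assumes g: "g \<in> L2 a b"
  shows "K_op a g \<in> L2 a b"
proof (rule bounded_L2[where C = "LINT y|lebesgue_on {a<..<b}. \<bar>g y\<bar>"])
  interpret finite_measure "lebesgue_on {a<..<b}" by (rule finite_measure_Ioo)
  have "(\<lambda>x. LINT y|lebesgue_on {a<..<b}. (if y < x then g y else 0))
      \<in> borel_measurable (lebesgue_on {a<..<b})"
    using measurable_truncation[OF L2_measurable[OF g]] by (rule borel_measurable_lebesgue_integral)
  then show "K_op a g \<in> borel_measurable (lebesgue_on {a<..<b})"
    by (rule measurable_cong[THEN iffD1, rotated]) (simp add: K_op_eq[of _ a b])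
  fix x assume x: "x \<in> {a<..<b}"
  have "\<bar>K_op a g x\<bar> \<le> (LINT y|lebesgue_on {a<..<b}. \<bar>if y < x then g y else 0\<bar>)"
    unfolding K_op_eq[OF x] by (rule integral_abs_bound)
  also have "\<dots> \<le> (LINT y|lebesgue_on {a<..<b}. \<bar>g y\<bar>)"
    using truncation_integrable[OF g] L2_integrable[OF g]
    by (intro integral_mono integrable_abs) auto
  finally show "\<bar>K_op a g x\<bar> \<le> (LINT y|lebesgue_on {a<..<b}. \<bar>g y\<bar>)" .
qed

lemma K_op_cong:
  assumes "L2_eq a b f g" "g \<in> L2 a b" "x \<in> {a<..<b}"
  shows "K_op a f x = K_op a g x"
proof -
  note L2_eq_measurable[OF assms(1) L2_measurable[OF assms(2)], measurable]
    and L2_measurable[OF assms(2), measurable]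
  have "AE y in lebesgue_on {a<..<b}. (if y < x then f y else 0) = (if y < x then g y else 0)"
    using assms(1) unfolding L2_eq_def by (rule AE_mp) simp
  then show ?thesis
    unfolding K_op_eq[OF assms(3)] by (intro integral_cong_AE) measurable
qed

lemma K_op_lin:
  assumes "f \<in> L2 a b" "g \<in> L2 a b" "x \<in> {a<..<b}"
  shows "K_op a (\<lambda>y. f y + c * g y) x = K_op a f x + c * K_op a g x"
proof -
  have "K_op a (\<lambda>y. f y + c * g y) x = (LINT y|lebesgue_on {a<..<b}.
      (if y < x then f y else 0) + c * (if y < x then g y else 0))"
    unfolding K_op_eq[OF assms(3)] by (intro Bochner_Integration.integral_cong) auto
  also have "\<dots> = K_op a f x + c * K_op a g x"
    unfolding K_op_eq[OF assms(3)] using truncation_integrable assms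
    by (subst Bochner_Integration.integral_add) auto
  finally show ?thesis .
qed

lemma K_op_0 [simp]: "K_op a (\<lambda>y. 0) x = 0"
  by (simp add: K_op_def)

text \<open>Fubini on the triangle y < x turns the pairing with \<phi>' into the integral of g(y)
  (\<phi>(b) - \<phi>(y)), and \<phi>(b) = 0.\<close>

lemma has_weak_deriv_K_op:
  assumes g: "g \<in> L2 a b"
  shows "has_weak_deriv a b 1 (K_op a g) g"
  unfolding has_weak_deriv_def
proof
  fix \<phi> assume \<phi>: "\<phi> \<in> test_funs a b"
  let ?M = "lebesgue_on {a<..<b}"
  let ?\<psi> = "deriv \<phi>"
  have \<psi>: "?\<psi> \<in> L2 a b"
    by (intro test_funs_L2 test_funs_deriv \<phi>)
  interpret finite_measure ?M by (rule finite_measure_Ioo)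
  interpret P: pair_sigma_finite ?M ?M ..
  note [measurable] = L2_measurable[OF g] L2_measurable[OF \<psi>] measurable_truncation[OF L2_measurable[OF g]]
  \<comment> \<open>The untruncated product has separated variables and dominates the truncated
    integrand.\<close>
  have "integrable (?M \<Otimes>\<^sub>M ?M) (\<lambda>(x, y). ?\<psi> x * g y)"
  proof (rule P.Fubini_integrable)
    show "integrable ?M (\<lambda>x. LINT y|?M. norm (case (x, y) of (x, y) \<Rightarrow> ?\<psi> x * g y))"
      using L2_integrable[OF \<psi>] by (simp add: abs_mult)
    show "AE x in ?M. integrable ?M (\<lambda>y. case (x, y) of (x, y) \<Rightarrow> ?\<psi> x * g y)"
      using L2_integrable[OF g] by simp
  qed measurable
  then have int: "integrable (?M \<Otimes>\<^sub>M ?M) (\<lambda>(x, y). ?\<psi> x * (if y < x then g y else 0))"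
  proof (rule Bochner_Integration.integrable_bound)
    show "(\<lambda>(x, y). ?\<psi> x * (if y < x then g y else 0)) \<in> borel_measurable (?M \<Otimes>\<^sub>M ?M)"
      by measurable
  qed auto
  have "L2_inner a b (K_op a g) ?\<psi> = (LINT x|?M. LINT y|?M. ?\<psi> x * (if y < x then g y else 0))"
    unfolding L2_inner_def
    by (intro Bochner_Integration.integral_cong) (simp_all add: K_op_eq[of _ a b] mult.commute)
  also have "\<dots> = (LINT y|?M. LINT x|?M. ?\<psi> x * (if y < x then g y else 0))"
    using P.Fubini_integral[OF int] by simp
  also have "\<dots> = (LINT y|?M. - (g y * \<phi> y))"
  proof (intro Bochner_Integration.integral_cong refl)
    fix y assume "y \<in> space ?M"
    then have y: "a < y" "y < b" by auto
    have "(LINT x|?M. ?\<psi> x * (if y < x then g y else 0)) =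
        (LINT x|?M. g y * (indicator {y<..<b} x * ?\<psi> x))"
      by (intro Bochner_Integration.integral_cong) (auto simp: indicator_def)
    also have "\<dots> = g y * (LINT x|lebesgue_on {y<..<b}. ?\<psi> x)"
      using y by (subst integral_lebesgue_on_Ioo_subset[of y b a b]) auto
    also have "(LINT x|lebesgue_on {y<..<b}. ?\<psi> x) = \<phi> b - \<phi> y"
      using y by (intro integral_lebesgue_on_Ioo_FTC smooth_DERIV smooth_continuous_on
          test_funs_smooth[OF \<phi>] test_funs_smooth[OF test_funs_deriv[OF \<phi>]]) auto
    also have "\<phi> b = 0" using test_funs_0[OF \<phi>] by simp
    finally show "(LINT x|?M. ?\<psi> x * (if y < x then g y else 0)) = - (g y * \<phi> y)" by simp
  qed
  finally show "L2_inner a b (K_op a g) ((deriv ^^ 1) \<phi>) = (-1) ^ 1 * L2_inner a b g \<phi>"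
    by (simp add: L2_inner_def)
qed

lemma has_weak_deriv_const:
  assumes "a < b"
  shows "has_weak_deriv a b 1 (\<lambda>x. c) (\<lambda>x. 0)"
  unfolding has_weak_deriv_def
proof
  fix \<phi> assume \<phi>: "\<phi> \<in> test_funs a b"
  have "(LINT x|lebesgue_on {a<..<b}. deriv \<phi> x) = \<phi> b - \<phi> a"
    using assms by (intro integral_lebesgue_on_Ioo_FTC smooth_DERIV smooth_continuous_on
          test_funs_smooth[OF \<phi>] test_funs_smooth[OF test_funs_deriv[OF \<phi>]]) auto
  also have "\<dots> = 0" using test_funs_0[OF \<phi>] by simp
  finally show "L2_inner a b (\<lambda>x. c) ((deriv ^^ 1) \<phi>) = (-1) ^ 1 * L2_inner a b (\<lambda>x. 0) \<phi>"
    by (simp add: L2_inner_def)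
qed

subsection \<open>Finite dimensional subspaces and projections\<close>

text \<open>The zero subspace, given by all representatives of its only element.\<close>

definition null_space :: "real \<Rightarrow> real \<Rightarrow> (real \<Rightarrow> real) set" where
  "null_space a b = {f. L2_eq a b f (\<lambda>x. 0)}"

definition extend_space ::
    "real \<Rightarrow> real \<Rightarrow> (real \<Rightarrow> real) set \<Rightarrow> (real \<Rightarrow> real) \<Rightarrow> (real \<Rightarrow> real) set" where
  "extend_space a b S g = {f. \<exists>s\<in>S. \<exists>c. L2_eq a b f (\<lambda>x. s x + c * g x)}"

text \<open>Generators are adjoined one at a time, so that facts about finite dimensional subspaces
  follow by induction. The new generator may already lie in \<open>S\<close>; no independence is
  demanded.\<close>

inductive fin_dim :: "real \<Rightarrow> real \<Rightarrow> (real \<Rightarrow> real) set \<Rightarrow> bool" for a b where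
  null: "fin_dim a b (null_space a b)"
| extend: "fin_dim a b S \<Longrightarrow> g \<in> L2 a b \<Longrightarrow> fin_dim a b (extend_space a b S g)"

lemma fin_dim_L2:
  assumes "fin_dim a b S" "f \<in> S"
  shows "f \<in> L2 a b"
  using assms
  by (induction arbitrary: f)
    (auto simp: null_space_def extend_space_def intro: L2_eq_L2 const_L2 L2_lin)

lemma fin_dim_cong:
  assumes "fin_dim a b S" "f' \<in> S" "L2_eq a b f f'"
  shows "f \<in> S"
  using assms
  by cases (auto simp: null_space_def extend_space_def intro: L2_eq_trans)

lemma fin_dim_0: "fin_dim a b S \<Longrightarrow> (\<lambda>x. 0) \<in> S"
  by (induction rule: fin_dim.induct)
    (auto simp: null_space_def extend_space_def intro!: bexI[of _ "\<lambda>x. 0"] exI[of _ 0])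

lemma null_space_subset: "fin_dim a b S \<Longrightarrow> null_space a b \<subseteq> S"
  using fin_dim_cong fin_dim_0 by (fastforce simp: null_space_def)

lemma fin_dim_lin:
  assumes "fin_dim a b S" "f \<in> S" "f' \<in> S"
  shows "(\<lambda>x. f x + k * f' x) \<in> S"
  using assms
proof (induction arbitrary: f f')
  case null
  then show ?case
    using L2_eq_lin[of a b f "\<lambda>x. 0" f' "\<lambda>x. 0" k] by (simp add: null_space_def)
next
  case (extend S g)
  then obtain s c s' c' where s: "s \<in> S" "s' \<in> S"
    and "L2_eq a b f (\<lambda>x. s x + c * g x)" "L2_eq a b f' (\<lambda>x. s' x + c' * g x)"
    by (auto simp: extend_space_def)
  then have "L2_eq a b (\<lambda>x. f x + k * f' x) (\<lambda>x. (s x + c * g x) + k * (s' x + c' * g x))"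
    by (intro L2_eq_lin)
  also have "(\<lambda>x. (s x + c * g x) + k * (s' x + c' * g x)) = (\<lambda>x. (s x + k * s' x) + (c + k * c') * g x)"
    by (auto simp: algebra_simps)
  finally show ?case
    using extend.IH[OF s] by (auto simp: extend_space_def)
qed

lemma fin_dim_diff: "fin_dim a b S \<Longrightarrow> f \<in> S \<Longrightarrow> g \<in> S \<Longrightarrow> (\<lambda>x. f x - g x) \<in> S"
  using fin_dim_lin[of a b S f g "-1"] by simp

text \<open>One Gram--Schmidt step: \<open>g\<close> is replaced by its component \<open>e\<close> orthogonal to \<open>S\<close>.\<close>

lemma fin_dim_projection_ex:
  assumes "fin_dim a b S" "u \<in> L2 a b"
  shows "\<exists>v\<in>S. \<forall>w\<in>S. L2_inner a b (\<lambda>x. u x - v x) w = 0"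
  using assms
proof (induction arbitrary: u)
  case null
  have "L2_inner a b (\<lambda>x. u x - 0) w = 0" if "w \<in> null_space a b" for w
    using that L2_inner_cong[of a b w "\<lambda>x. 0" u] null const_L2
    by (simp add: null_space_def L2_inner_def mult.commute[of "u _"])
  then show ?case
    using fin_dim_0[OF fin_dim.null] by (intro bexI[of _ "\<lambda>x. 0"]) auto
next
  case (extend S g)
  note SL2 = fin_dim_L2[OF extend.hyps(1)]
  obtain v where v: "v \<in> S" "\<And>w. w \<in> S \<Longrightarrow> L2_inner a b (\<lambda>x. u x - v x) w = 0"
    using extend.IH[OF extend.prems] by blast
  obtain g' where g': "g' \<in> S" "\<And>w. w \<in> S \<Longrightarrow> L2_inner a b (\<lambda>x. g x - g' x) w = 0"
    using extend.IH[OF extend.hyps(2)] by blast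
  define e where "e = (\<lambda>x. g x - g' x)"
  \<comment> \<open>If \<open>e\<close> vanishes almost everywhere, that is, if \<open>g\<close>
    already lies in \<open>S\<close>, the quotient is 0/0, which is 0.\<close>
  define k where "k = L2_inner a b (\<lambda>x. u x - v x) e / L2_inner a b e e"
  have eL2: "e \<in> L2 a b" and uvL2: "(\<lambda>x. u x - v x) \<in> L2 a b"
    unfolding e_def using extend SL2 g'(1) v(1) by (auto intro: L2_diff)
  have e0: "L2_inner a b e w = 0" if "w \<in> S" for w
    using g'(2)[OF that] by (simp add: e_def)
  let ?r = "\<lambda>x. (u x - v x) + (- k) * e x"
  have r_e: "L2_inner a b ?r e = 0"
  proof (cases "L2_inner a b e e = 0")
    case True
    have "L2_inner a b (\<lambda>x. u x - v x) e = L2_inner a b e (\<lambda>x. u x - v x)"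
      by (rule L2_inner_commute)
    also have "\<dots> = L2_inner a b (\<lambda>x. 0) (\<lambda>x. u x - v x)"
      by (intro L2_inner_cong L2_inner_self_0 eL2 True const_L2 uvL2)
    finally show ?thesis
      using True by (subst L2_inner_lin[OF uvL2 eL2 eL2]) (simp add: L2_inner_def)
  next
    case False
    then show ?thesis
      by (subst L2_inner_lin[OF uvL2 eL2 eL2]) (simp add: k_def)
  qed
  have r_S: "L2_inner a b ?r w = 0" if "w \<in> S" for w
    using that v(2) e0 by (subst L2_inner_lin[OF uvL2 eL2 SL2]) auto
  have rL2: "?r \<in> L2 a b"
    by (intro L2_lin uvL2 eL2)
  have orth: "L2_inner a b ?r w = 0" if w_mem: "w \<in> extend_space a b S g" for w
  proof -
    obtain s c where s: "s \<in> S" and w: "L2_eq a b w (\<lambda>x. s x + c * g x)"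
      using w_mem by (auto simp: extend_space_def)
    have eq: "(\<lambda>x. s x + c * g x) = (\<lambda>x. (s x + c * g' x) + c * e x)"
      by (auto simp: e_def algebra_simps)
    have sS: "(\<lambda>x. s x + c * g' x) \<in> S"
      by (intro fin_dim_lin[OF extend.hyps(1)] s g')
    have "L2_inner a b ?r w = L2_inner a b w ?r"
      by (rule L2_inner_commute)
    also have "\<dots> = L2_inner a b (\<lambda>x. (s x + c * g' x) + c * e x) ?r"
      using w L2_lin[OF SL2[OF sS] eL2, of c] rL2 unfolding eq by (rule L2_inner_cong)
    also have "\<dots> = L2_inner a b ?r (\<lambda>x. s x + c * g' x) + c * L2_inner a b ?r e"
      using SL2[OF sS] eL2 rL2 by (subst L2_inner_lin) (auto simp: L2_inner_commute)
    also have "\<dots> = 0"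
      using r_e r_S[OF sS] by simp
    finally show ?thesis .
  qed
  \<comment> \<open>The new projection rewritten in terms of \<open>g\<close> instead of
    \<open>e\<close>, the form in which \<open>extend_space\<close> describes its elements.\<close>
  have "(\<lambda>x. v x + k * e x) = (\<lambda>x. (v x + (- k) * g' x) + k * g x)"
    by (auto simp: e_def algebra_simps)
  moreover have "(\<lambda>x. v x + (- k) * g' x) \<in> S"
    by (intro fin_dim_lin[OF extend.hyps(1)] v g')
  ultimately have "(\<lambda>x. v x + k * e x) \<in> extend_space a b S g"
    unfolding extend_space_def
    by (intro CollectI bexI[of _ "\<lambda>x. v x + (- k) * g' x"] exI[of _ k]) auto
  moreover have "(\<lambda>x. u x - (v x + k * e x)) = ?r"
    by (auto simp: algebra_simps)
  ultimately show ?case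
    using orth by (intro bexI[of _ "\<lambda>x. v x + k * e x"]) auto
qed

lemma L2_proj_props:
  assumes "fin_dim a b S" "u \<in> L2 a b"
  shows "L2_proj a b S u \<in> S"
    and "\<And>w. w \<in> S \<Longrightarrow> L2_inner a b (\<lambda>x. u x - L2_proj a b S u x) w = 0"
proof -
  have "\<exists>v. v \<in> S \<and> (\<forall>w\<in>S. L2_inner a b (\<lambda>x. u x - v x) w = 0)"
    using fin_dim_projection_ex[OF assms] by blast
  from someI_ex[OF this] show "L2_proj a b S u \<in> S"
    and "\<And>w. w \<in> S \<Longrightarrow> L2_inner a b (\<lambda>x. u x - L2_proj a b S u x) w = 0"
    unfolding L2_proj_def by blast+
qed

lemma fin_dim_subspace_fin_dim:
  assumes "fin_dim_subspace a b S"
  shows "fin_dim a b S"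
proof -
  obtain B where B: "finite B" "B \<subseteq> L2 a b" and
    S: "S = {f. \<exists>c. L2_eq a b f (\<lambda>x. \<Sum>g\<in>B. c g * g x)}"
    using assms by (auto simp: fin_dim_subspace_def)
  have "fin_dim a b {f. \<exists>c. L2_eq a b f (\<lambda>x. \<Sum>g\<in>B. c g * g x)}"
    using B
  proof (induction B rule: finite_induct)
    case empty
    then show ?case using fin_dim.null[of a b] by (simp add: null_space_def)
  next
    case (insert g B)
    have "{f. \<exists>c. L2_eq a b f (\<lambda>x. \<Sum>h\<in>insert g B. c h * h x)} =
      extend_space a b {f. \<exists>c. L2_eq a b f (\<lambda>x. \<Sum>h\<in>B. c h * h x)} g" (is "?L = ?R")
    proof (intro equalityI subsetI)
      fix f assume "f \<in> ?L"
      then obtain c where "L2_eq a b f (\<lambda>x. \<Sum>h\<in>insert g B. c h * h x)" by blast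
      then have "L2_eq a b f (\<lambda>x. (\<Sum>h\<in>B. c h * h x) + c g * g x)"
        using insert.hyps by (simp add: add.commute)
      then show "f \<in> ?R"
        unfolding extend_space_def
      by (intro CollectI bexI[of _ "\<lambda>x. \<Sum>h\<in>B. c h * h x"] exI[of _ "c g"])
        (auto intro!: exI[of _ c])
    next
      fix f assume "f \<in> ?R"
      then obtain s c k where s: "L2_eq a b s (\<lambda>x. \<Sum>h\<in>B. c h * h x)"
        and f: "L2_eq a b f (\<lambda>x. s x + k * g x)" by (auto simp: extend_space_def)
      note f
      also have "L2_eq a b (\<lambda>x. s x + k * g x) (\<lambda>x. (\<Sum>h\<in>B. c h * h x) + k * g x)"
        by (intro L2_eq_lin s L2_eq_refl)
      \<comment> \<open>The value of \<open>c\<close> at \<open>g\<close> is arbitrary because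
        \<open>g\<close> is not in \<open>B\<close>; it is overwritten by \<open>k\<close>.\<close>
      also have "(\<lambda>x. (\<Sum>h\<in>B. c h * h x) + k * g x) = (\<lambda>x. \<Sum>h\<in>insert g B. (c(g := k)) h * h x)"
      proof
        fix x
        have "(\<Sum>h\<in>B. (c(g := k)) h * h x) = (\<Sum>h\<in>B. c h * h x)"
          using insert.hyps by (intro sum.cong) auto
        then show "(\<Sum>h\<in>B. c h * h x) + k * g x = (\<Sum>h\<in>insert g B. (c(g := k)) h * h x)"
          using insert.hyps by simp
      qed
      finally show "f \<in> ?L" by blast
    qed
    then show ?case using insert by (simp add: fin_dim.extend)
  qed
  then show ?thesis by (simp add: S)
qed

section \<open>Constants plus primitives\<close>

lemma poly_space_0_iff: "f \<in> poly_space a b 0 \<longleftrightarrow> (\<exists>c. L2_eq a b f (\<lambda>x. c))"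
proof
  assume "f \<in> poly_space a b 0"
  then obtain p where p: "degree p = 0" "L2_eq a b f (poly p)"
    by (force simp: poly_space_def)
  then obtain c where "p = [:c:]" using degree_eq_zeroE by blast
  then have "poly p = (\<lambda>x. c)" by auto
  with p show "\<exists>c. L2_eq a b f (\<lambda>x. c)" by auto
next
  assume "\<exists>c. L2_eq a b f (\<lambda>x. c)"
  moreover have "poly [:c:] = (\<lambda>x. c)" for c :: real by auto
  ultimately obtain c where "L2_eq a b f (poly [:c:])" by metis
  then show "f \<in> poly_space a b 0"
    unfolding poly_space_def by (intro CollectI exI[of _ "[:c:]"]) simp
qed

text \<open>The summand from \<open>poly_space a b 0\<close> ranges over all representatives of a
  constant and so absorbs any discrepancy on a null set. Equality of functions may thus be relaxed
  to \<open>L2_eq\<close>.\<close>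

lemma P0_plus_image_iff:
  "f \<in> P0_plus_image a b T S \<longleftrightarrow> (\<exists>c. \<exists>h\<in>S. L2_eq a b f (\<lambda>x. c + T h x))"
proof
  assume "f \<in> P0_plus_image a b T S"
  then obtain p h c where "f = (\<lambda>x. p x + T h x)" "h \<in> S" "L2_eq a b p (\<lambda>x. c)"
    by (auto simp: P0_plus_image_def poly_space_0_iff)
  then show "\<exists>c. \<exists>h\<in>S. L2_eq a b f (\<lambda>x. c + T h x)"
    using L2_eq_lin[of a b p "\<lambda>x. c" "T h" "T h" 1] by auto
next
  assume "\<exists>c. \<exists>h\<in>S. L2_eq a b f (\<lambda>x. c + T h x)"
  then obtain c h where h: "h \<in> S" "L2_eq a b f (\<lambda>x. c + T h x)" by blast
  have "L2_eq a b (\<lambda>x. f x - T h x) (\<lambda>x. c)"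
    using L2_eq_lin[OF h(2) L2_eq_refl[of a b "T h"], of "-1"] by simp
  then have "(\<lambda>x. f x - T h x) \<in> poly_space a b 0"
    by (auto simp: poly_space_0_iff)
  moreover have "f = (\<lambda>x. (f x - T h x) + T h x)" by simp
  ultimately show "f \<in> P0_plus_image a b T S"
    unfolding P0_plus_image_def using h(1)
    by (intro CollectI exI[of _ "\<lambda>x. f x - T h x"] exI[of _ h]) simp
qed

text \<open>Applied to the zero subspace the construction gives the constants, and a generator
  \<open>g\<close> of the old space becomes the generator \<open>K_op a g\<close> of the new
  one.\<close>

lemma fin_dim_P0_plus_image:
  assumes "fin_dim a b S"
  shows "fin_dim a b (P0_plus_image a b (K_op a) S)"
  using assms
proof induction
  case null
  have "P0_plus_image a b (K_op a) (null_space a b) = extend_space a b (null_space a b) (\<lambda>x. 1)"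
    (is "?L = ?R")
  proof (intro equalityI subsetI)
    fix f assume "f \<in> ?L"
    then obtain c h where h: "L2_eq a b h (\<lambda>x. 0)" and f: "L2_eq a b f (\<lambda>x. c + K_op a h x)"
      by (auto simp: P0_plus_image_iff null_space_def)
    note f
    also have "L2_eq a b (\<lambda>x. c + K_op a h x) (\<lambda>x. 0 + c * 1)"
      by (rule L2_eqI) (simp add: K_op_cong[OF h const_L2])
    finally show "f \<in> ?R"
      unfolding extend_space_def null_space_def
      by (intro CollectI bexI[of _ "\<lambda>x. 0"] exI[of _ c]) auto
  next
    fix f assume "f \<in> ?R"
    then obtain s c where s: "L2_eq a b s (\<lambda>x. 0)" and f: "L2_eq a b f (\<lambda>x. s x + c * 1)"
      by (auto simp: extend_space_def null_space_def)
    note f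
    also have "L2_eq a b (\<lambda>x. s x + c * 1) (\<lambda>x. 0 + c * 1)"
      by (intro L2_eq_lin s L2_eq_refl)
    finally have "L2_eq a b f (\<lambda>x. c + K_op a (\<lambda>x. 0) x)" by simp
    then show "f \<in> ?L"
      unfolding P0_plus_image_iff null_space_def using L2_eq_refl by blast
  qed
  then show ?case
    by (simp add: fin_dim.intros const_L2)
next
  case (extend S g)
  note SL2 = fin_dim_L2[OF extend.hyps(1)]
  have "P0_plus_image a b (K_op a) (extend_space a b S g) =
      extend_space a b (P0_plus_image a b (K_op a) S) (K_op a g)" (is "?L = ?R")
  proof (intro equalityI subsetI)
    fix f assume "f \<in> ?L"
    then obtain c h s k where s: "s \<in> S" and h: "L2_eq a b h (\<lambda>x. s x + k * g x)"
      and f: "L2_eq a b f (\<lambda>x. c + K_op a h x)"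
      by (auto simp: P0_plus_image_iff extend_space_def)
    note f
    also have "L2_eq a b (\<lambda>x. c + K_op a h x) (\<lambda>x. (c + K_op a s x) + k * K_op a g x)"
      using SL2[OF s] extend.hyps(2)
      by (intro L2_eqI) (simp add: K_op_cong[OF h] L2_lin K_op_lin)
    finally have "L2_eq a b f (\<lambda>x. (c + K_op a s x) + k * K_op a g x)" .
    moreover have "(\<lambda>x. c + K_op a s x) \<in> P0_plus_image a b (K_op a) S"
      unfolding P0_plus_image_iff using s L2_eq_refl by blast
    ultimately show "f \<in> ?R"
      unfolding extend_space_def
      by (intro CollectI bexI[of _ "\<lambda>x. c + K_op a s x"] exI[of _ k])
  next
    fix f assume "f \<in> ?R"
    then obtain c r s k where s: "s \<in> S" and r: "L2_eq a b r (\<lambda>x. c + K_op a s x)"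
      and f: "L2_eq a b f (\<lambda>x. r x + k * K_op a g x)"
      by (auto simp: P0_plus_image_iff extend_space_def)
    note f
    also have "L2_eq a b (\<lambda>x. r x + k * K_op a g x) (\<lambda>x. (c + K_op a s x) + k * K_op a g x)"
      by (intro L2_eq_lin r L2_eq_refl)
    also have "L2_eq a b \<dots> (\<lambda>x. c + K_op a (\<lambda>x. s x + k * g x) x)"
      using SL2[OF s] extend.hyps(2) by (intro L2_eqI) (simp add: K_op_lin)
    finally have "L2_eq a b f (\<lambda>x. c + K_op a (\<lambda>x. s x + k * g x) x)" .
    moreover have "(\<lambda>x. s x + k * g x) \<in> extend_space a b S g"
      unfolding extend_space_def using s L2_eq_refl by blast
    ultimately show "f \<in> ?L"
      unfolding P0_plus_image_iff by blast
  qed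
  then show ?case
    using extend by (simp add: fin_dim.extend K_op_L2)
qed

subsection \<open>Iterated primitives\<close>


text \<open>The recursion can be started from any set. Started at level \<open>m\<close> it presents
  level \<open>q + m\<close> as the set of \<open>q\<close>-fold primitives of elements of level
  \<open>m\<close>.\<close>

lemma Z_space_add: "Z_space a b S (q + m) = Z_space a b (Z_space a b S m) q"
  by (induction q) auto

lemma fin_dim_Z_space: "fin_dim a b S \<Longrightarrow> fin_dim a b (Z_space a b S t)"
  by (induction t) (auto intro: fin_dim_P0_plus_image)

lemma Z_space_iff_singleton: "w \<in> Z_space a b S q \<longleftrightarrow> (\<exists>g\<in>S. w \<in> Z_space a b {g} q)"
proof (induction q arbitrary: w)
  case (Suc q)
  then show ?case by (simp add: P0_plus_image_iff) blast
qed simp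

lemma Z_spaceI: "g \<in> S \<Longrightarrow> w \<in> Z_space a b {g} q \<Longrightarrow> w \<in> Z_space a b S q"
  by (subst Z_space_iff_singleton) blast

lemma Z_spaceE:
  assumes "w \<in> Z_space a b S q"
  obtains g where "g \<in> S" "w \<in> Z_space a b {g} q"
  using assms by (subst (asm) Z_space_iff_singleton) blast

lemma Z_space_mono: "S \<subseteq> T \<Longrightarrow> Z_space a b S q \<subseteq> Z_space a b T q"
  by (meson Z_spaceE Z_spaceI subset_iff)

text \<open>Applied to a singleton \<open>{g}\<close>, this provides a \<open>q\<close>-fold
  primitive of \<open>g\<close>.\<close>

lemma Z_space_nonempty: "S \<noteq> {} \<Longrightarrow> Z_space a b S q \<noteq> {}"
proof (induction q)
  case (Suc q)
  then obtain h where "h \<in> Z_space a b S q" by auto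
  then have "(\<lambda>x. 0 + K_op a h x) \<in> Z_space a b S (Suc q)"
    using L2_eq_refl unfolding Z_space.simps P0_plus_image_iff by blast
  then show ?case by blast
qed simp

text \<open>Membership in \<open>Z_space a b {g} q\<close> says that \<open>w\<close> is a \<open>q\<close>-fold primitive of \<open>g\<close>.\<close>

lemma Z_space_singleton_weak_deriv:
  assumes "a < b" "g \<in> L2 a b" "w \<in> Z_space a b {g} q"
  shows "w \<in> L2 a b \<and> has_weak_deriv a b q w g"
  using assms(3)
proof (induction q arbitrary: w)
  case 0
  then show ?case using assms(2) by (simp add: has_weak_deriv_0)
next
  case (Suc q)
  then obtain c h where h: "h \<in> Z_space a b {g} q" and w: "L2_eq a b w (\<lambda>x. c + K_op a h x)"
    by (auto simp: P0_plus_image_iff)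
  note IH = Suc.IH[OF h]
  have L2: "(\<lambda>x. c + K_op a h x) \<in> L2 a b"
    using IH by (intro L2_add const_L2 K_op_L2) simp
  have "has_weak_deriv a b 1 (\<lambda>x. c + 1 * K_op a h x) (\<lambda>x. 0 + 1 * h x)"
    using IH by (intro has_weak_deriv_lin has_weak_deriv_const has_weak_deriv_K_op const_L2 K_op_L2
        assms(1)) auto
  then have "has_weak_deriv a b 1 w h"
    using has_weak_deriv_cong[OF w L2] by simp
  then show ?case
    using IH has_weak_deriv_Suc L2_eq_L2[OF w L2] by blast
qed

section \<open>Polynomials as iterated primitives of zero\<close>

lemma poly_antiderivative:
  fixes p :: "real poly"
  obtains P where "pderiv P = p" "degree P \<le> Suc (degree p)"
proof
  let ?P = "\<Sum>i\<le>degree p. monom (coeff p i / real (Suc i)) (Suc i)"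
  have "pderiv ?P = (\<Sum>i\<le>degree p. monom (coeff p i) i)"
    using higher_pderiv_sum[of 1 "\<lambda>i. monom (coeff p i / real (Suc i)) (Suc i)" "{..degree p}"]
    by (simp add: pderiv_monom del: of_nat_Suc)
  then show "pderiv ?P = p"
    by (simp add: poly_as_sum_of_monoms)
  show "degree ?P \<le> Suc (degree p)"
    by (intro degree_sum_le) (auto intro: order_trans[OF degree_monom_le])
qed

lemma poly_L2: "poly p \<in> L2 a b"
  by (intro continuous_L2 continuous_intros)

lemma K_op_pderiv: "a < x \<Longrightarrow> K_op a (poly (pderiv p)) x = poly p x - poly p a"
  unfolding K_op_def
  by (intro integral_lebesgue_on_Ioo_FTC) (auto intro: poly_DERIV continuous_on_poly continuous_on_id)

text \<open>Each integration adds a constant and raises the degree bound by one. At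
  \<open>q = 0\<close> the bound is -1 and both sides are the zero subspace. The identity also makes
  polynomials of bounded degree a \<open>fin_dim\<close> space.\<close>

lemma poly_space_eq_Z_space: "poly_space a b (int q - 1) = Z_space a b (null_space a b) q"
proof (induction q)
  case 0
  have "p = 0 \<or> int (degree p) \<le> -1 \<longleftrightarrow> p = 0" for p :: "real poly" by auto
  moreover have "poly 0 = (\<lambda>x. 0 :: real)" by auto
  ultimately show ?case by (simp add: poly_space_def null_space_def)
next
  case (Suc q)
  have "poly_space a b (int q) = P0_plus_image a b (K_op a) (poly_space a b (int q - 1))"
  proof (intro equalityI subsetI)
    fix f assume "f \<in> poly_space a b (int q)"
    then obtain p where p: "degree p \<le> q" "L2_eq a b f (poly p)"
      by (force simp: poly_space_def)
    have "L2_eq a b (poly p) (\<lambda>x. poly p a + K_op a (poly (pderiv p)) x)"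
      by (rule L2_eqI) (simp add: K_op_pderiv)
    with p(2) have "L2_eq a b f (\<lambda>x. poly p a + K_op a (poly (pderiv p)) x)"
      by (rule L2_eq_trans)
    moreover have "pderiv p = 0 \<or> int (degree (pderiv p)) \<le> int q - 1"
      using p(1) by (cases "degree p = 0") (auto simp: pderiv_eq_0_iff degree_pderiv)
    then have "poly (pderiv p) \<in> poly_space a b (int q - 1)"
      unfolding poly_space_def using L2_eq_refl by blast
    ultimately show "f \<in> P0_plus_image a b (K_op a) (poly_space a b (int q - 1))"
      unfolding P0_plus_image_iff by blast
  next
    fix f assume "f \<in> P0_plus_image a b (K_op a) (poly_space a b (int q - 1))"
    then obtain c h p where f: "L2_eq a b f (\<lambda>x. c + K_op a h x)"
      and p: "p = 0 \<or> int (degree p) \<le> int q - 1" and h: "L2_eq a b h (poly p)"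
      by (auto simp: P0_plus_image_iff poly_space_def)
    have "\<exists>P. pderiv P = p \<and> degree P \<le> q"
    \<comment> \<open>The general antiderivative bound gives only degree \<le> 1 for the zero
      polynomial, too weak when \<open>q = 0\<close>.\<close>
    proof (cases "p = 0")
      case True
      then show ?thesis by (intro exI[of _ 0]) simp
    next
      case False
      then have "Suc (degree p) \<le> q" using p by auto
      then show ?thesis by (metis poly_antiderivative order_trans)
    qed
    then obtain P where P: "pderiv P = p" "degree P \<le> q" by blast
    \<comment> \<open>The antiderivative of \<open>p\<close> with value \<open>c\<close> at
      \<open>a\<close>.\<close>
    let ?R = "P + [:c - poly P a:]"
    note f
    also have "L2_eq a b (\<lambda>x. c + K_op a h x) (poly ?R)"
      using P(1) K_op_pderiv[of a _ P] by (intro L2_eqI) (simp add: K_op_cong[OF h poly_L2])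
    finally have "L2_eq a b f (poly ?R)" .
    moreover have "degree ?R \<le> q"
      using P(2) by (intro degree_add_le) auto
    ultimately show "f \<in> poly_space a b (int q)"
      unfolding poly_space_def by (intro CollectI exI[of _ ?R]) auto
  qed
  then show ?case using Suc by simp
qed

section \<open>Weak derivatives of Sobolev functions and of the recursive projector\<close>

lemma sobolev_weak_deriv_ex:
  assumes "u \<in> sobolev a b q"
  shows "\<exists>v\<in>L2 a b. has_weak_deriv a b q u v"
proof (cases q)
  case 0
  then show ?thesis using assms has_weak_deriv_0 by (auto simp: sobolev_def)
next
  case (Suc n)
  then show ?thesis using assms by (auto simp: sobolev_def)
qed

lemma sobolev_weak_deriv_1:
  assumes "u \<in> sobolev a b (Suc q)"
  shows "weak_deriv a b 1 u \<in> sobolev a b q" "has_weak_deriv a b 1 u (weak_deriv a b 1 u)"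
proof -
  obtain w where "w \<in> L2 a b" "has_weak_deriv a b 1 u w"
    using assms by (fastforce simp: sobolev_def)
  note w = weak_deriv_props[OF this]
  show "has_weak_deriv a b 1 u (weak_deriv a b 1 u)" by (rule w)
  have "\<exists>v\<in>L2 a b. has_weak_deriv a b n (weak_deriv a b 1 u) v" if "n \<in> {1..q}" for n
  proof -
    have "Suc n \<in> {1..Suc q}" using that by simp
    then obtain v where "v \<in> L2 a b" "has_weak_deriv a b (Suc n) u v"
      using assms unfolding sobolev_def by blast
    then show ?thesis using has_weak_deriv_SucD w(2) by blast
  qed
  then show "weak_deriv a b 1 u \<in> sobolev a b q"
    using w(1) by (simp add: sobolev_def)
qed

text \<open>The commuting property: the derivative of order \<open>q\<close> of
  \<open>Q_proj a b Z0 q t u\<close> is the orthogonal projection of that of \<open>u\<close> onto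
  level \<open>t - q\<close>. Each recursive step integrates once, with the point value at
  \<open>a\<close> as constant of integration, until the projection at order 0 is reached.\<close>

lemma Q_proj_weak_deriv:
  assumes "fin_dim a b Z0" "u \<in> sobolev a b q" "v \<in> L2 a b" "has_weak_deriv a b q u v" "q \<le> t"
  shows "\<exists>g\<in>Z_space a b Z0 (t - q). Q_proj a b Z0 q t u \<in> Z_space a b {g} q \<and>
    (\<forall>w\<in>Z_space a b Z0 (t - q). L2_inner a b (\<lambda>x. v x - g x) w = 0)"
  using assms(2-5)
proof (induction q arbitrary: t u)
  case 0
  note fd = fin_dim_Z_space[OF assms(1), of t]
  have u: "u \<in> L2 a b" using 0 by (simp add: sobolev_def)
  let ?P = "L2_proj a b (Z_space a b Z0 t) u"
  note P = L2_proj_props[OF fd u]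
  have vu: "L2_eq a b v u"
    using has_weak_deriv_unique[OF 0(2) u 0(3) has_weak_deriv_0] .
  have "L2_inner a b (\<lambda>x. v x - ?P x) w = 0" if "w \<in> Z_space a b Z0 t" for w
  proof -
    have "L2_inner a b v w = L2_inner a b u w"
      using vu u fin_dim_L2[OF fd that] by (rule L2_inner_cong)
    then show ?thesis
      using P(2)[OF that] fin_dim_L2[OF fd] P(1) that u 0(2) by (simp add: L2_inner_diff)
  qed
  then show ?case using P(1) by auto
next
  case (Suc q)
  then obtain t' where t: "t = Suc t'" by (cases t) auto
  let ?w = "weak_deriv a b 1 u"
  note w = sobolev_weak_deriv_1[OF Suc.prems(1)]
  \<comment> \<open>The top derivative \<open>v\<close> stays the same while \<open>u\<close> is
    replaced by its first derivative.\<close>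
  have "has_weak_deriv a b q ?w v"
    using w(2) Suc.prems(3) by (rule has_weak_deriv_SucD)
  then obtain g where g: "g \<in> Z_space a b Z0 (t' - q)" "Q_proj a b Z0 q t' ?w \<in> Z_space a b {g} q"
    "\<forall>w\<in>Z_space a b Z0 (t' - q). L2_inner a b (\<lambda>x. v x - g x) w = 0"
    using Suc.IH[OF w(1) Suc.prems(2), of t'] Suc.prems(4) t by auto
  have "Q_proj a b Z0 (Suc q) t u \<in> Z_space a b {g} (Suc q)"
    using g(2) L2_eq_refl unfolding t Z_space.simps P0_plus_image_iff Q_proj.simps diff_Suc_1 by blast
  then show ?case using g t by auto
qed

section \<open>Comparison of the two projectors\<close>

theorem proposition2:
  fixes a b :: real and Z0 :: "(real \<Rightarrow> real) set" and q t :: nat and u :: "real \<Rightarrow> real"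
  assumes "a < b"
    and "fin_dim_subspace a b Z0"
    and "poly_space a b 0 \<subseteq> Z0"
    and "\<And>s. P0_plus_image a b (K_op a) (Z_space a b Z0 s)
             = P0_plus_image a b (K_adj b) (Z_space a b Z0 s)"
    and "q \<le> t"
    and "u \<in> sobolev a b q"
  shows "L2_eq a b (\<lambda>x. Ritz_proj a b Z0 q t u x - Q_proj a b Z0 q t u x)
           (L2_proj a b (poly_space a b (int q - 1)) (\<lambda>x. u x - Q_proj a b Z0 q t u x))
       \<and> L2_proj a b (poly_space a b (int q - 1)) (\<lambda>x. u x - Q_proj a b Z0 q t u x)
           \<in> poly_space a b (int q - 1)"
proof -
  let ?S = "Z_space a b Z0 (t - q)" and ?Z = "Z_space a b Z0 t"
  let ?P = "poly_space a b (int q - 1)" and ?D = "weak_deriv a b q"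
  define Q where "Q = Q_proj a b Z0 q t u"
  define R where "R = Ritz_proj a b Z0 q t u"
  define E where "E = L2_proj a b ?P (\<lambda>x. u x - Q x)"
  have fdZ0: "fin_dim a b Z0" by (rule fin_dim_subspace_fin_dim[OF assms(2)])
  note fdS = fin_dim_Z_space[OF fdZ0, of "t - q"] and fdZ = fin_dim_Z_space[OF fdZ0, of t]
  have fdP: "fin_dim a b ?P"
    unfolding poly_space_eq_Z_space by (intro fin_dim_Z_space fin_dim.null)
  have ZS: "?Z = Z_space a b ?S q"
    using Z_space_add[of a b Z0 q "t - q"] assms(5) by simp
  \<comment> \<open>Polynomials are \<open>q\<close>-fold primitives of zero, and zero lies in
    \<open>?S\<close>.\<close>
  have PZ: "?P \<subseteq> ?Z"
    unfolding ZS poly_space_eq_Z_space by (intro Z_space_mono null_space_subset fdS)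
  have deriv: "?D w \<in> L2 a b" "L2_eq a b (?D w) g" "has_weak_deriv a b q w g" "w \<in> L2 a b"
    if "g \<in> ?S" "w \<in> Z_space a b {g} q" for g w
    using that fin_dim_L2[OF fdS] Z_space_singleton_weak_deriv[OF assms(1) _ that(2)]
      weak_deriv_props by blast+

  have u: "u \<in> L2 a b" using assms(6) by (simp add: sobolev_def)
  obtain v0 where "v0 \<in> L2 a b" "has_weak_deriv a b q u v0"
    using sobolev_weak_deriv_ex[OF assms(6)] by blast
  note Du = weak_deriv_props[OF this]
  \<comment> \<open>\<open>gQ\<close> is the projection of the derivative of \<open>u\<close> onto
    \<open>?S\<close>, and \<open>Q\<close> is one of its \<open>q\<close>-fold primitives.\<close>
  obtain gQ where gQ: "gQ \<in> ?S" "Q \<in> Z_space a b {gQ} q"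
    "\<And>w. w \<in> ?S \<Longrightarrow> L2_inner a b (\<lambda>x. ?D u x - gQ x) w = 0"
    using Q_proj_weak_deriv[OF fdZ0 assms(6) Du(1,2) assms(5)] unfolding Q_def by blast
  have QZ: "Q \<in> ?Z" unfolding ZS by (rule Z_spaceI[OF gQ(1,2)])
  have QL2: "Q \<in> L2 a b" by (rule fin_dim_L2[OF fdZ QZ])
  have gQ_inner: "L2_inner a b gQ w = L2_inner a b (?D u) w" if "w \<in> ?S" for w
    using gQ(3)[OF that] Du(1) gQ(1) that fin_dim_L2[OF fdS] by (simp add: L2_inner_diff)

  have uQ: "(\<lambda>x. u x - Q x) \<in> L2 a b" by (rule L2_diff[OF u QL2])
  have E: "E \<in> ?P" "\<And>w. w \<in> ?P \<Longrightarrow> L2_inner a b (\<lambda>x. (u x - Q x) - E x) w = 0"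
    unfolding E_def using L2_proj_props[OF fdP uQ] by blast+
  have EL2: "E \<in> L2 a b" by (rule fin_dim_L2[OF fdP E(1)])
  have E_inner: "L2_inner a b E w = L2_inner a b u w - L2_inner a b Q w" if "w \<in> ?P" for w
    using E(2)[OF that] u QL2 EL2 fin_dim_L2[OF fdP that] by (simp add: L2_inner_diff L2_diff)

  \<comment> \<open>\<open>Ritz_proj\<close> is a choice, so its equations become available only
    after some solution has been exhibited.\<close>
  have ex: "\<exists>r. r \<in> ?Z \<and> (\<forall>v\<in>?Z. L2_inner a b (?D r) (?D v) = L2_inner a b (?D u) (?D v)) \<and>
     (\<forall>g\<in>?P. L2_inner a b r g = L2_inner a b u g)"
  proof (intro exI conjI ballI)
    \<comment> \<open>\<open>E\<close> corrects the moments against \<open>?P\<close> without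
      changing the derivative of order \<open>q\<close>. The factor 1 fits the shape of the
      linearity lemmas.\<close>
    let ?r = "\<lambda>x. Q x + 1 * E x"
    show "?r \<in> ?Z" using fin_dim_lin[OF fdZ QZ] PZ E(1) by blast
    obtain e where e: "e \<in> null_space a b" "E \<in> Z_space a b {e} q"
      using E(1) unfolding poly_space_eq_Z_space by (rule Z_spaceE)
    then have eS: "e \<in> ?S" using null_space_subset[OF fdS] by blast
    note eL2 = fin_dim_L2[OF fdS eS] and gQL2 = fin_dim_L2[OF fdS gQ(1)]
    have "has_weak_deriv a b q ?r (\<lambda>x. gQ x + 1 * e x)"
      using deriv[OF gQ(1,2)] deriv[OF eS e(2)] eL2 gQL2 by (intro has_weak_deriv_lin) auto
    from weak_deriv_props(3)[OF L2_lin[OF gQL2 eL2] this]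
    have "L2_eq a b (?D ?r) (\<lambda>x. gQ x + 1 * e x)" .
    also have "L2_eq a b \<dots> (\<lambda>x. gQ x + 1 * 0)"
      using e(1) by (intro L2_eq_lin L2_eq_refl) (simp add: null_space_def)
    finally have Dr: "L2_eq a b (?D ?r) gQ" by simp
    fix v assume "v \<in> ?Z"
    then obtain g where g: "g \<in> ?S" "v \<in> Z_space a b {g} q"
      unfolding ZS by (rule Z_spaceE)
    note Dv = deriv[OF g] and gL2 = fin_dim_L2[OF fdS g(1)]
    have "L2_inner a b (?D ?r) (?D v) = L2_inner a b gQ (?D v)"
      by (rule L2_inner_cong[OF Dr gQL2 Dv(1)])
    also have "\<dots> = L2_inner a b gQ g"
      using L2_inner_cong[OF Dv(2) gL2 gQL2] by (simp add: L2_inner_commute[of a b gQ])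
    also have "\<dots> = L2_inner a b (?D u) g" by (rule gQ_inner[OF g(1)])
    also have "\<dots> = L2_inner a b (?D u) (?D v)"
      using L2_inner_cong[OF Dv(2) gL2 Du(1)] by (simp add: L2_inner_commute[of a b "?D u"])
    finally show "L2_inner a b (?D ?r) (?D v) = L2_inner a b (?D u) (?D v)" .
  next
    fix g assume g: "g \<in> ?P"
    show "L2_inner a b (\<lambda>x. Q x + 1 * E x) g = L2_inner a b u g"
      using E_inner[OF g] QL2 EL2 fin_dim_L2[OF fdP g] by (subst L2_inner_lin) auto
  qed
  have R: "R \<in> ?Z" "\<And>v. v \<in> ?Z \<Longrightarrow> L2_inner a b (?D R) (?D v) = L2_inner a b (?D u) (?D v)"
    "\<And>g. g \<in> ?P \<Longrightarrow> L2_inner a b R g = L2_inner a b u g"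
    using someI_ex[OF ex] unfolding R_def Ritz_proj_def by blast+
  have RL2: "R \<in> L2 a b" by (rule fin_dim_L2[OF fdZ R(1)])
  obtain gR where gR: "gR \<in> ?S" "R \<in> Z_space a b {gR} q"
    using R(1) unfolding ZS by (rule Z_spaceE)
  \<comment> \<open>Every \<open>g\<close> in \<open>?S\<close> is the derivative of some
    \<open>v\<close> in \<open>?Z\<close>, so the Ritz equations test against all of
    \<open>?S\<close>. Thus \<open>gR\<close>, like \<open>gQ\<close>, is an orthogonal projection
    of the derivative of \<open>u\<close> onto \<open>?S\<close>.\<close>
  have gR_inner: "L2_inner a b gR g = L2_inner a b (?D u) g" if g: "g \<in> ?S" for g
  proof -
    obtain v where v: "v \<in> Z_space a b {g} q"
      using Z_space_nonempty[of "{g}" a b q] by blast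
    have vZ: "v \<in> ?Z" unfolding ZS by (rule Z_spaceI[OF g v])
    note Dv = deriv[OF g v] and gL2 = fin_dim_L2[OF fdS g] and gRL2 = fin_dim_L2[OF fdS gR(1)]
    have "L2_inner a b gR g = L2_inner a b gR (?D v)"
      using L2_inner_cong[OF Dv(2) gL2 gRL2] by (simp add: L2_inner_commute[of a b gR])
    also have "\<dots> = L2_inner a b (?D R) (?D v)"
      using L2_inner_cong[OF deriv(2)[OF gR] gRL2 Dv(1)] by simp
    also have "\<dots> = L2_inner a b (?D u) (?D v)" by (rule R(2)[OF vZ])
    also have "\<dots> = L2_inner a b (?D u) g"
      using L2_inner_cong[OF Dv(2) gL2 Du(1)] by (simp add: L2_inner_commute[of a b "?D u"])
    finally show ?thesis .
  qed

  define d where "d = (\<lambda>x. R x - Q x)"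
  have "d \<in> ?Z" unfolding d_def by (rule fin_dim_diff[OF fdZ R(1) QZ])
  then obtain gd where gd: "gd \<in> ?S" "d \<in> Z_space a b {gd} q"
    unfolding ZS by (rule Z_spaceE)
  note gdL2 = fin_dim_L2[OF fdS gd(1)]
    and gRL2 = fin_dim_L2[OF fdS gR(1)] and gQL2 = fin_dim_L2[OF fdS gQ(1)]
  have "has_weak_deriv a b q (\<lambda>x. R x + (-1) * Q x) (\<lambda>x. gR x + (-1) * gQ x)"
    using deriv[OF gR] deriv[OF gQ(1,2)] gRL2 gQL2 by (intro has_weak_deriv_lin) auto
  then have "L2_eq a b gd (\<lambda>x. gR x - gQ x)"
    using deriv(3)[OF gd] has_weak_deriv_unique[OF gdL2 L2_diff[OF gRL2 gQL2]] by (simp add: d_def)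
  \<comment> \<open>\<open>gR\<close> and \<open>gQ\<close> have equal inner products with all of
    \<open>?S\<close>, and \<open>gd\<close> itself lies in \<open>?S\<close>, so \<open>gd\<close>
    is orthogonal to itself.\<close>
  then have "L2_inner a b gd gd = L2_inner a b (\<lambda>x. gR x - gQ x) gd"
    using L2_diff[OF gRL2 gQL2] gdL2 by (rule L2_inner_cong)
  also have "\<dots> = 0"
    using gR_inner[OF gd(1)] gQ_inner[OF gd(1)] gRL2 gQL2 gdL2 by (simp add: L2_inner_diff)
  finally have "gd \<in> null_space a b"
    using L2_inner_self_0[OF gdL2] by (simp add: null_space_def)
  then have dP: "d \<in> ?P"
    unfolding poly_space_eq_Z_space using gd(2) by (rule Z_spaceI)
  have dE: "(\<lambda>x. d x - E x) \<in> ?P"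
    by (rule fin_dim_diff[OF fdP dP E(1)])
  \<comment> \<open>Against \<open>?P\<close>, \<open>R\<close> has the moments of \<open>u\<close>
    and \<open>E\<close> those of \<open>u - Q\<close>. Hence \<open>d - E\<close> is orthogonal to
    \<open>?P\<close>, to which it belongs.\<close>
  have "L2_inner a b (\<lambda>x. d x - E x) (\<lambda>x. d x - E x) = 0"
    using E_inner[OF dE] R(3)[OF dE] fin_dim_L2[OF fdP dP] fin_dim_L2[OF fdP dE] EL2 RL2 QL2
    by (simp add: L2_inner_diff d_def)
  then have "L2_eq a b d E"
    using L2_inner_self_0[OF fin_dim_L2[OF fdP dE]] by (simp add: L2_eq_diff_0)
  then show ?thesis
    using E(1) unfolding d_def R_def Q_def E_def by simp
qed

end
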